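(* The following hold for invariant domains of the constrained Riemann solver $\mathcal{R}_1^{\rm c}$. (a) If $Q_0<Q(u_{\rm c}(W_{\max}))$, then $\Omega_{\rm f}\cup\{u=(\rho,v)\in\Omega_{\rm c}: Q(u)\le Q_0\le p^{-1}(W_{\max}-v)\,v\}$ is the smallest invariant domain containing $\Omega_{\rm f}$. (b) If $Q_0\ge Q(u_{\rm c}(W_{\max}))$, then $\Omega_{\rm f}\cup\{u=(\rho,v)\in\Omega_{\rm c}: v=V_{\rm c}\}$ is the smallest invariant domain containing $\Omega_{\rm f}$. (c) If $Q_0\ge Q(u_{\rm c}(W_{\rm c}))$, then $\Omega_{\rm c}$ is the smallest invariant domain containing $\Omega_{\rm c}$. (d) If $Q_0<Q(u_{\rm c}(W_{\rm c}))$, then $\Omega_{\rm c}\cup\{u\in\Omega_{\rm f}': Q(u)=Q_0\}$ is the smallest invariant domain containing $\Omega_{\rm c}$.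
   Context: **Data.** Fix $R_{\rm f}''>R_{\rm f}'>0$, $V\in C^2([0,R_{\rm f}''];[0,\infty))$ with $V(R_{\rm f}'')>0$, and $p\in C^2((0,+\infty);\mathbb{R})$ such that: for all $\rho\in[0,R_{\rm f}'']$, $V'(\rho)\le0$, $V(\rho)+\rho V'(\rho)>0$, $2V'(\rho)+\rho V''(\rho)\le0$; for all $\rho\in(0,+\infty)$, $p'(\rho)>0$, $2p'(\rho)+\rho p''(\rho)>0$; for all $\rho\in[R_{\rm f}',R_{\rm f}'']$, $V'(\rho)+p'(\rho)>0$, $V(\rho)<\rho p'(\rho)$. Put $V_{\max}=V(0)$, $V_{\min}=V(R_{\rm f}'')$, $W_{\max}=p(R_{\rm f}'')+V_{\min}$, $W_{\rm c}=p(R_{\rm f}')+V(R_{\rm f}')$, $R_{\max}=p^{-1}(W_{\max})$, $q_{\max}=R_{\rm f}''V_{\min}$. Fix $V_{\rm c}\in(0,V_{\min}]$ and $Q_0\in(0,q_{\max})$. **State space.** States are $u=(\rho,v)$ (density, speed). $\Omega_{\rm f}=\{u\in[0,R_{\rm f}'']\times[V_{\min},V_{\max}]: v=V(\rho)\}$, $\Omega_{\rm c}=\{u\in[R_{\rm f}',R_{\max}]\times[0,V_{\rm c}]: W_{\rm c}\le v+p(\rho)\le W_{\max}\}$, $\Omega=\Omega_{\rm f}\cup\Omega_{\rm c}$, $\Omega_{\rm f}'=\{u\in\Omega_{\rm f}:\rho<R_{\rm f}'\}$, $\Omega_{\rm f}''=\{u\in\Omega_{\rm f}:\rho\ge R_{\rm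 f}'\}$. $Q(u)=\rho v$; $W(u)=v+p(\rho)$ if $u\in\Omega_{\rm c}\cup\Omega_{\rm f}''$ and $W(u)=W_{\rm c}$ if $u\in\Omega_{\rm f}'$. Subscripts carry over: $u_*=(\rho_*,v_* )$, $q_*=Q(u_* )$, $w_*=W(u_* )$. For $w\in[W_{\rm c},W_{\max}]$: $u_{\rm c}(w)=(p^{-1}(w-V_{\rm c}),V_{\rm c})\in\Omega_{\rm c}$, and $u_{\rm f}(w)=(\rho_{\rm f}(w),v_{\rm f}(w))\in\Omega_{\rm f}''$ is defined by $v_{\rm f}(w)=V(\rho_{\rm f}(w))=w-p(\rho_{\rm f}(w))$. For $\rho_\ell\ne\rho_r$, $\sigma(u_\ell,u_r)=(q_r-q_\ell)/(\rho_r-\rho_\ell)$. **Riemann solvers.** For Riemann data $u_\ell$ ($x<0$), $u_r$ ($x>0$), a Riemann solver gives the self-similar profile, a function of $x$ (solution $(t,x)\mapsto\mathcal{R}[u_\ell,u_r](x/t)$); pointwise values are those of the right-continuous representative. $\mathcal{R}_{\rm LWR}$ is the standard (entropy) Riemann solver for $\rho_t+(\rho V(\rho))_x=0$, $v=V(\rho)$, in $\Omega_{\rm f}$ (concave flux). $\mathcal{R}_{\rm ARZ}$ is the standard (Lax) Riemann solver for the Aw–Rascle–Zhang system $\rho_t+(\rho v)_x=0$, $(\rho W)_t+(\rho vW)_x=0$ with $W=v+p(\rho)$ in $\Omega_{\rm c}$: $u_\ell$ is joined to $(p^{-1}(w_\ell-v_r),v_r)$ by a 1-wave (shock if $v_r<v_\ell$,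 rarefaction if $v_r>v_\ell$; $\lambda_1=v-\rho p'(\rho)$), which is joined to $u_r$ by a contact discontinuity of speed $v_r$. $\mathcal{R}_1$ on $\Omega^2$: $\mathcal{R}_1=\mathcal{R}_{\rm LWR}$ on $\Omega_{\rm f}^2$; $\mathcal{R}_1=\mathcal{R}_{\rm ARZ}$ on $\Omega_{\rm c}^2$; if $(u_\ell,u_r)\in\Omega_{\rm f}\times\Omega_{\rm c}$, with $u_m=(p^{-1}(w_\ell-v_r),v_r)$, $\mathcal{R}_1[u_\ell,u_r](x)=u_\ell$ for $x<\sigma(u_\ell,u_m)$ and $=\mathcal{R}_{\rm ARZ}[u_m,u_r](x)$ for $x>\sigma(u_\ell,u_m)$; if $(u_\ell,u_r)\in\Omega_{\rm c}\times\Omega_{\rm f}$, $\mathcal{R}_1[u_\ell,u_r](x)=\mathcal{R}_{\rm ARZ}[u_\ell,u_{\rm c}(w_\ell)](x)$ for $x<\sigma(u_{\rm c}(w_\ell),u_{\rm f}(w_\ell))$ and $=\mathcal{R}_{\rm LWR}[u_{\rm f}(w_\ell),u_r](x)$ for $x>\sigma(u_{\rm c}(w_\ell),u_{\rm f}(w_\ell))$. **Constrained solver $\mathcal{R}_1^{\rm c}$.** Let $\mathcal{C}_1=\{(u_\ell,u_r)\in\Omega^2: Q(\mathcal{R}_1[u_\ell,u_r](0^\pm))\le Q_0\}$ and $\mathcal{N}_1=\{(u_\ell,u_r)\in\Omega^2: Q(\mathcal{R}_1[u_\ell,u_r](0^\pm))>Q_0\}$. If $(u_\ell,u_r)\in\mathcal{C}_1$,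 $\mathcal{R}_1^{\rm c}[u_\ell,u_r]=\mathcal{R}_1[u_\ell,u_r]$. If $(u_\ell,u_r)\in\mathcal{N}_1$, $\mathcal{R}_1^{\rm c}[u_\ell,u_r](x)=\mathcal{R}_1[u_\ell,\hat u](x)$ for $x<0$ and $=\mathcal{R}_1[\check u,u_r](x)$ for $x>0$, where $(\hat u,\check u)\in\Omega_{\rm c}\times\Omega$ is the unique pair with: (A) $\mathcal{R}_1[u_\ell,\hat u](0^-)=\hat u$, $\mathcal{R}_1[\check u,u_r](0^+)=\check u$, $Q(\hat u)=Q(\check u)\le Q_0$, $W(\hat u)=w_\ell$; (B) any other pair $(\hat u',\check u')\in\Omega^2$ satisfying (A) has $Q(\hat u')<Q(\hat u)$. **Invariant domain.** $D\subseteq\Omega$ is an invariant domain for $\mathcal{R}_1^{\rm c}$ if $\mathcal{R}_1^{\rm c}[u_\ell,u_r](\mathbb{R})\subseteq D$ for all $u_\ell,u_r\in D$. The smallest invariant domain containing a set $A$ is the invariant domain containing $A$ that is contained in every invariant domain containing $A$.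
   Formalization: If V_c=V_min the phases overlap, so the clauses for R_1 conflict and the pair in (A),(B) need not be unique; there the in-phase solvers take precedence (LWR, then ARZ), and among pairs of equal maximal flux the one with ǔ in Ω_c is chosen. For V_c<V_min nothing is changed. *)

theory Defs
  imports "HOL-Analysis.Analysis"
begin

text \<open>
  Two-phase (free / congested) traffic model, its Riemann solver \<open>R1\<close> and the solver
  \<open>R1c\<close> with the point constraint \<open>Q \<le> Q0\<close> at \<open>x = 0\<close>. A state is a pair (density, speed).
  The fields \<open>V'\<close>, \<open>V''\<close>, \<open>p'\<close>, \<open>p''\<close> are tied to \<open>V\<close> and \<open>p\<close> in the locale
  \<open>traffic_model\<close> below. At the ends of \<open>[0, Rf'']\<close> the derivatives of \<open>V\<close> are one-sided,
  and values of \<open>V\<close> outside \<open>[0, Rf'']\<close> and of \<open>p\<close> outside \<open>(0, \<infinity>)\<close> are irrelevant.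
\<close>

record traffic_data =
  Rf' :: real
  Rf'' :: real
  V :: "real \<Rightarrow> real"
  V' :: "real \<Rightarrow> real"
  V'' :: "real \<Rightarrow> real"
  p :: "real \<Rightarrow> real"
  p' :: "real \<Rightarrow> real"
  p'' :: "real \<Rightarrow> real"
  Vc :: real
  Q0 :: real

type_synonym state = "real \<times> real"

definition Vmax :: "traffic_data \<Rightarrow> real" where
  "Vmax M = V M 0"

definition Vmin :: "traffic_data \<Rightarrow> real" where
  "Vmin M = V M (Rf'' M)"

definition Wmax :: "traffic_data \<Rightarrow> real" where
  "Wmax M = p M (Rf'' M) + Vmin M"

definition Wc :: "traffic_data \<Rightarrow> real" where
  "Wc M = p M (Rf' M) + V M (Rf' M)"

definition p_inv :: "traffic_data \<Rightarrow> real \<Rightarrow> real" where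
  "p_inv M = the_inv_into {0<..} (p M)"

definition Rmax :: "traffic_data \<Rightarrow> real" where
  "Rmax M = p_inv M (Wmax M)"

definition qmax :: "traffic_data \<Rightarrow> real" where
  "qmax M = Rf'' M * Vmin M"

locale traffic_model =
  fixes M :: traffic_data
  assumes Rf: "0 < Rf' M" "Rf' M < Rf'' M"
    and V_C2:
      "\<And>\<rho>. \<rho> \<in> {0..Rf'' M} \<Longrightarrow> (V M has_real_derivative V' M \<rho>) (at \<rho> within {0..Rf'' M})"
      "\<And>\<rho>. \<rho> \<in> {0..Rf'' M} \<Longrightarrow> (V' M has_real_derivative V'' M \<rho>) (at \<rho> within {0..Rf'' M})"
      "continuous_on {0..Rf'' M} (V'' M)"
    and V_nonneg: "\<And>\<rho>. \<rho> \<in> {0..Rf'' M} \<Longrightarrow> 0 \<le> V M \<rho>"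
    and V_end_pos: "0 < V M (Rf'' M)"
    and p_C2:
      "\<And>\<rho>. 0 < \<rho> \<Longrightarrow> (p M has_real_derivative p' M \<rho>) (at \<rho>)"
      "\<And>\<rho>. 0 < \<rho> \<Longrightarrow> (p' M has_real_derivative p'' M \<rho>) (at \<rho>)"
      "continuous_on {0<..} (p'' M)"
    and V_cond:
      "\<And>\<rho>. \<rho> \<in> {0..Rf'' M} \<Longrightarrow> V' M \<rho> \<le> 0"
      "\<And>\<rho>. \<rho> \<in> {0..Rf'' M} \<Longrightarrow> 0 < V M \<rho> + \<rho> * V' M \<rho>"
      "\<And>\<rho>. \<rho> \<in> {0..Rf'' M} \<Longrightarrow> 2 * V' M \<rho> + \<rho> * V'' M \<rho> \<le> 0"
    and p_cond:
      "\<And>\<rho>. 0 < \<rho> \<Longrightarrow> 0 < p' M \<rho>"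
      "\<And>\<rho>. 0 < \<rho> \<Longrightarrow> 0 < 2 * p' M \<rho> + \<rho> * p'' M \<rho>"
    and Vp_cond:
      "\<And>\<rho>. \<rho> \<in> {Rf' M..Rf'' M} \<Longrightarrow> 0 < V' M \<rho> + p' M \<rho>"
      "\<And>\<rho>. \<rho> \<in> {Rf' M..Rf'' M} \<Longrightarrow> V M \<rho> < \<rho> * p' M \<rho>"
    and Vc_range: "0 < Vc M" "Vc M \<le> Vmin M"
    and Q0_range: "0 < Q0 M" "Q0 M < qmax M"

definition Omega_f :: "traffic_data \<Rightarrow> state set" where
  "Omega_f M = {(\<rho>, v). \<rho> \<in> {0..Rf'' M} \<and> v \<in> {Vmin M..Vmax M} \<and> v = V M \<rho>}"

definition Omega_c :: "traffic_data \<Rightarrow> state set" where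
  "Omega_c M = {(\<rho>, v). \<rho> \<in> {Rf' M..Rmax M} \<and> v \<in> {0..Vc M} \<and>
                        Wc M \<le> v + p M \<rho> \<and> v + p M \<rho> \<le> Wmax M}"

definition Omega :: "traffic_data \<Rightarrow> state set" where
  "Omega M = Omega_f M \<union> Omega_c M"

definition Omega_f' :: "traffic_data \<Rightarrow> state set" where
  "Omega_f' M = {u \<in> Omega_f M. fst u < Rf' M}"

definition Omega_f'' :: "traffic_data \<Rightarrow> state set" where
  "Omega_f'' M = {u \<in> Omega_f M. Rf' M \<le> fst u}"

definition Q :: "state \<Rightarrow> real" where
  "Q u = fst u * snd u"

definition W :: "traffic_data \<Rightarrow> state \<Rightarrow> real" where
  "W M u = (if u \<in> Omega_c M \<union> Omega_f'' M then snd u + p M (fst u) else Wc M)"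

definition u_c :: "traffic_data \<Rightarrow> real \<Rightarrow> state" where
  "u_c M w = (p_inv M (w - Vc M), Vc M)"

definition u_f :: "traffic_data \<Rightarrow> real \<Rightarrow> state" where
  "u_f M w = (THE u. u \<in> Omega_f'' M \<and> snd u = V M (fst u) \<and> snd u = w - p M (fst u))"

text \<open>With division by zero being zero, \<open>sigma\<close> of two states of equal density is \<open>0\<close>; in the
  solvers this only ever happens for two equal states, between which there is no jump.\<close>

definition sigma :: "state \<Rightarrow> state \<Rightarrow> real" where
  "sigma ul ur = (Q ur - Q ul) / (fst ur - fst ul)"

text \<open>All profiles below are the right-continuous representatives.

  The flux \<open>\<rho> V(\<rho>)\<close> is concave, not necessarily strictly concave: increasing densities are
  joined by one shock, decreasing ones by a rarefaction, in which \<open>lambda_f\<close> may be constant on a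
  density interval. The profile then jumps across that interval, and the infimum selects the
  right limit.\<close>

definition lambda_f :: "traffic_data \<Rightarrow> real \<Rightarrow> real" where
  "lambda_f M \<rho> = V M \<rho> + \<rho> * V' M \<rho>"

definition R_LWR :: "traffic_data \<Rightarrow> state \<Rightarrow> state \<Rightarrow> real \<Rightarrow> state" where
  "R_LWR M ul ur x =
    (if fst ul \<le> fst ur then
       (if x < sigma ul ur then ul else ur)
     else if x < lambda_f M (fst ul) then ul
     else if x < lambda_f M (fst ur) then
       (let \<rho> = Inf {\<rho> \<in> {fst ur..fst ul}. lambda_f M \<rho> = x} in (\<rho>, V M \<rho>))
     else ur)"

definition lambda_1 :: "traffic_data \<Rightarrow> state \<Rightarrow> real" where
  "lambda_1 M u = snd u - fst u * p' M (fst u)"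

text \<open>The 1-wave from \<open>ul\<close> to \<open>um\<close>, for \<open>ul\<close> and \<open>um\<close> in \<open>Omega_c\<close> with \<open>W M um = W M ul\<close>.
  Inside a rarefaction fan the state is determined by \<open>w\<close> and \<open>lambda_1\<close>, since \<open>lambda_1\<close> is
  strictly monotone along the curve of constant \<open>w\<close>.\<close>

definition wave_1 :: "traffic_data \<Rightarrow> state \<Rightarrow> state \<Rightarrow> real \<Rightarrow> state" where
  "wave_1 M ul um x =
    (if snd um \<le> snd ul then
       (if x < sigma ul um then ul else um)
     else if x < lambda_1 M ul then ul
     else if x < lambda_1 M um then
       (THE u. u \<in> Omega_c M \<and> W M u = W M ul \<and> lambda_1 M u = x)
     else um)"

definition u_m :: "traffic_data \<Rightarrow> state \<Rightarrow> state \<Rightarrow> state" where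
  "u_m M ul ur = (p_inv M (W M ul - snd ur), snd ur)"

definition R_ARZ :: "traffic_data \<Rightarrow> state \<Rightarrow> state \<Rightarrow> real \<Rightarrow> state" where
  "R_ARZ M ul ur x = (if x < snd ur then wave_1 M ul (u_m M ul ur) x else ur)"

text \<open>The phases are disjoint if \<open>Vc < Vmin\<close>. If \<open>Vc = Vmin\<close> they meet (at least in
  \<open>(Rf'', Vmin)\<close>); there the solvers inside one phase take precedence over the phase transitions.
  On \<open>(Omega_f \<inter> Omega_c)\<^sup>2\<close> the solvers \<open>R_LWR\<close> and \<open>R_ARZ\<close> coincide: both consist of one jump
  of speed \<open>Vc\<close>.\<close>

definition R1 :: "traffic_data \<Rightarrow> state \<Rightarrow> state \<Rightarrow> real \<Rightarrow> state" where
  "R1 M ul ur x =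
    (if ul \<in> Omega_f M \<and> ur \<in> Omega_f M then R_LWR M ul ur x
     else if ul \<in> Omega_c M \<and> ur \<in> Omega_c M then R_ARZ M ul ur x
     else if ul \<in> Omega_f M \<and> ur \<in> Omega_c M then
       (if x < sigma ul (u_m M ul ur) then ul else R_ARZ M (u_m M ul ur) ur x)
     else if ul \<in> Omega_c M \<and> ur \<in> Omega_f M then
       (let w = W M ul in
        if x < sigma (u_c M w) (u_f M w) then R_ARZ M ul (u_c M w) x
        else R_LWR M (u_f M w) ur x)
     else undefined)"

definition C1 :: "traffic_data \<Rightarrow> (state \<times> state) set" where
  "C1 M = {(ul, ur) \<in> Omega M \<times> Omega M.
     Q (Lim (at_left 0) (R1 M ul ur)) \<le> Q0 M \<and> Q (Lim (at_right 0) (R1 M ul ur)) \<le> Q0 M}"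

definition N1 :: "traffic_data \<Rightarrow> (state \<times> state) set" where
  "N1 M = {(ul, ur) \<in> Omega M \<times> Omega M.
     Q (Lim (at_left 0) (R1 M ul ur)) > Q0 M \<and> Q (Lim (at_right 0) (R1 M ul ur)) > Q0 M}"

definition cond_A :: "traffic_data \<Rightarrow> state \<Rightarrow> state \<Rightarrow> state \<Rightarrow> state \<Rightarrow> bool" where
  "cond_A M ul ur u_hat u_check \<longleftrightarrow>
     Lim (at_left 0) (R1 M ul u_hat) = u_hat \<and>
     Lim (at_right 0) (R1 M u_check ur) = u_check \<and>
     Q u_hat = Q u_check \<and> Q u_check \<le> Q0 M \<and> W M u_hat = W M ul"

text \<open>The second disjunct is a tie-break for \<open>Vc = Vmin\<close> only. In that case, for \<open>ur\<close> in
  \<open>Omega_f \<inter> Omega_c\<close>, one flux value can be attained by two admissible \<open>u_check\<close>, one in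
  \<open>Omega_f - Omega_c\<close> and one in \<open>Omega_c\<close>, so that maximality of the flux alone does not determine
  the pair; the state in \<open>Omega_c\<close> is then chosen.\<close>

definition cond_B :: "traffic_data \<Rightarrow> state \<Rightarrow> state \<Rightarrow> state \<Rightarrow> state \<Rightarrow> bool" where
  "cond_B M ul ur u_hat u_check \<longleftrightarrow>
     (\<forall>v_hat \<in> Omega M. \<forall>v_check \<in> Omega M.
        cond_A M ul ur v_hat v_check \<and> (v_hat, v_check) \<noteq> (u_hat, u_check) \<longrightarrow>
          Q v_hat < Q u_hat \<or>
          Vc M = Vmin M \<and> Q v_hat = Q u_hat \<and> u_check \<in> Omega_c M \<and> v_check \<notin> Omega_c M)"

definition constraint_pair :: "traffic_data \<Rightarrow> state \<Rightarrow> state \<Rightarrow> state \<times> state" where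
  "constraint_pair M ul ur =
     (THE (u_hat, u_check). u_hat \<in> Omega_c M \<and> u_check \<in> Omega M \<and>
        cond_A M ul ur u_hat u_check \<and> cond_B M ul ur u_hat u_check)"

definition R1c :: "traffic_data \<Rightarrow> state \<Rightarrow> state \<Rightarrow> real \<Rightarrow> state" where
  "R1c M ul ur x =
    (if (ul, ur) \<in> C1 M then R1 M ul ur x
     else if (ul, ur) \<in> N1 M then
       (let (u_hat, u_check) = constraint_pair M ul ur in
        if x < 0 then R1 M ul u_hat x else R1 M u_check ur x)
     else undefined)"

definition invariant_domain :: "traffic_data \<Rightarrow> state set \<Rightarrow> bool" where
  "invariant_domain M D \<longleftrightarrow>
     D \<subseteq> Omega M \<and> (\<forall>ul \<in> D. \<forall>ur \<in> D. range (R1c M ul ur) \<subseteq> D)"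

text \<open>\<open>D\<close> is the smallest invariant domain containing \<open>A\<close>.\<close>

definition smallest_invariant_domain :: "traffic_data \<Rightarrow> state set \<Rightarrow> state set \<Rightarrow> bool" where
  "smallest_invariant_domain M A D \<longleftrightarrow>
     invariant_domain M D \<and> A \<subseteq> D \<and> (\<forall>D'. invariant_domain M D' \<and> A \<subseteq> D' \<longrightarrow> D \<subseteq> D')"

end

theory Submission
  imports Defs
begin

text \<open>
  The key is a pair of coordinates. A congested state is determined by its speed \<open>v\<close>
  and by the value \<open>w\<close> of \<open>W\<close>, and \<open>Omega_c\<close> is the rectangle
  \<open>[0, Vc] \<times> [Wc, Wmax]\<close> in these coordinates. On a curve of constant
  \<open>w\<close> the flux, as a function of the density, is \<open>\<rho> (w - p \<rho>)\<close>.
  It is strictly concave because \<open>2 p' + \<rho> p'' > 0\<close>, and its slope is already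
  negative at the free state \<open>u_f w\<close> because \<open>V < \<rho> p'\<close> there, hence
  everywhere to the right of it (\<open>curve_order\<close>). So along each curve the flux is
  strictly increasing in \<open>v\<close> and is largest at \<open>u_f w\<close>, the speed
  \<open>lambda_1\<close> is negative and strictly increasing in \<open>v\<close>; for fixed
  \<open>v\<close> the flux is nondecreasing in \<open>w\<close>. The same concavity shows that
  \<open>p\<close> attains \<open>Wmax\<close>, so that all the inverses of \<open>p\<close> exist.

  For the solver \<open>R1\<close> this gives the sign of every wave speed. Waves inside the free
  phase move to the right, 1-waves move to the left, and a phase transition moves in the direction
  given by the comparison of the two fluxes. The states on both sides of the origin then have the
  same flux, and there is a closed formula for it in each of the four combinations of phases
  (\<open>trace_flux_free\<close> and its companions).

  For the constrained solver, the upstream trace lies on the curve of the left state, and by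
  monotonicity its flux is at most \<open>Q0\<close> and at most the flux at speed
  \<open>Vc\<close>; the minimum of the two is attained. For this flux there is exactly one
  downstream trace, up to the tie-break of \<open>cond_B\<close>: if the right state is congested,
  it is the congested state of the same speed when the flux is at least that of the state of this
  speed on the curve of \<open>Wc\<close>, and the free state of the same flux, of density below
  \<open>Rf'\<close>, otherwise (\<open>constraint_pair_description\<close>).

  Invariance of the four domains is now a comparison of fluxes and speeds. Each new congested state
  has a speed between those of two states of the domain or their traces, and its flux is bounded by
  theirs or by the flux at the origin. For minimality, constrained problems with left and right
  state \<open>u_f w\<close> produce the upstream traces (\<open>upstream_state_attained\<close>); a
  phase transition from \<open>u_f w\<close> to a trace of speed \<open>v\<close> then produces all
  further states \<open>(v, w)\<close> of the first two domains
  (\<open>transition_state_attained\<close>); the problem with both states \<open>u_c Wc\<close>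
  produces the additional free state of the last one.

  If \<open>Vc = Vmin\<close> the two phases meet. Either they meet in \<open>u_f Wmax\<close> only,
  or \<open>V\<close> is constant on \<open>(0, Rf'']\<close> (\<open>overlap_V_const\<close>). In
  both cases the two solvers agree on the overlap, so that the formulas for congested data hold
  there as well.
\<close>

section \<open>Monotonicity of pressure, velocity and flux\<close>

text \<open>
  Derivatives are taken within a set that contains the interval, because those of \<open>V\<close>
  are one-sided at the ends of its domain.
\<close>

lemma mean_value_within:
  fixes f f' :: "real \<Rightarrow> real"
  assumes "x < y" "{x..y} \<subseteq> S"
    and "\<And>z. z \<in> S \<Longrightarrow> (f has_real_derivative f' z) (at z within S)"
  shows "\<exists>z. x < z \<and> z < y \<and> f y - f x = (y - x) * f' z"
proof -
  have "(f has_derivative (*) (f' z)) (at z within {x..y})" if "x \<le> z" "z \<le> y" for z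
    using assms(2) that has_field_derivative_subset[OF assms(3)[of z] assms(2)]
    by (auto simp: has_field_derivative_def)
  then have "\<exists>z\<in>{x<..<y}. f y - f x = (*) (f' z) (y - x)"
    by (rule mvt_simple[OF assms(1)])
  then show ?thesis by (auto simp: mult.commute)
qed

lemma Lim_eventually_eq:
  fixes F :: "real \<Rightarrow> 'b::t2_space"
  assumes "eventually (\<lambda>x. F x = c) G" "G \<noteq> bot"
  shows "Lim G F = c"
  using assms by (intro tendsto_Lim tendsto_eventually)

text \<open>
  The inverse of the coordinates \<open>(snd u, W M u)\<close> on \<open>Omega_c\<close>.
\<close>

definition curve_state :: "traffic_data \<Rightarrow> real \<Rightarrow> real \<Rightarrow> state" where
  "curve_state M v w = (p_inv M (w - v), v)"

context traffic_model
begin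

lemma p_less: "0 < x \<Longrightarrow> x < y \<Longrightarrow> p M x < p M y"
  using mean_value_within[of x y "{0<..}" "p M" "p' M"] p_C2(1) p_cond(1)
  by (smt (verit, best) DERIV_subset atLeastAtMost_iff greaterThan_iff mult_pos_pos subsetI top_greatest)

lemma p_less_iff: "0 < x \<Longrightarrow> 0 < y \<Longrightarrow> p M x < p M y \<longleftrightarrow> x < y"
  using p_less by (metis linorder_neqE_linordered_idom order_less_asym)

lemma p_le_iff: "0 < x \<Longrightarrow> 0 < y \<Longrightarrow> p M x \<le> p M y \<longleftrightarrow> x \<le> y"
  using p_less_iff by (meson linorder_not_le)

lemma p_eq_iff: "0 < x \<Longrightarrow> 0 < y \<Longrightarrow> p M x = p M y \<longleftrightarrow> x = y"
  using p_less_iff by (metis linorder_neqE_linordered_idom order_less_irrefl)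

lemma p_inv_p: "0 < x \<Longrightarrow> p_inv M (p M x) = x"
  unfolding p_inv_def by (rule the_inv_into_f_f) (auto simp: inj_on_def p_eq_iff)

lemma continuous_p: "continuous_on {0<..} (p M)"
  using p_C2(1) by (intro DERIV_continuous_on) (auto intro: DERIV_subset)

lemma continuous_p': "continuous_on {0<..} (p' M)"
  using p_C2(2) by (intro DERIV_continuous_on) (auto intro: DERIV_subset)

lemma continuous_V: "continuous_on {0..Rf'' M} (V M)"
  using V_C2(1) by (intro DERIV_continuous_on) auto

lemma continuous_V': "continuous_on {0..Rf'' M} (V' M)"
  using V_C2(2) by (intro DERIV_continuous_on) auto

lemma V_antimono: "0 \<le> x \<Longrightarrow> x \<le> y \<Longrightarrow> y \<le> Rf'' M \<Longrightarrow> V M y \<le> V M x"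
  using mean_value_within[of x y "{0..Rf'' M}" "V M" "V' M"] V_C2(1) V_cond(1)
  by (smt (verit, best) atLeastAtMost_iff atLeastatMost_subset_iff mult_nonneg_nonpos)

lemma V_plus_p_less:
  assumes "Rf' M \<le> x" "x < y" "y \<le> Rf'' M"
  shows "V M x + p M x < V M y + p M y"
proof -
  have "((\<lambda>x. V M x + p M x) has_real_derivative V' M z + p' M z) (at z within {Rf' M..Rf'' M})"
    if "z \<in> {Rf' M..Rf'' M}" for z
    using that Rf V_C2(1)[of z] p_C2(1)[of z]
    by (intro derivative_intros) (auto intro: has_field_derivative_subset has_field_derivative_at_within)
  from mean_value_within[OF assms(2) _ this] assms Vp_cond(1) show ?thesis
    by (smt (verit, best) atLeastAtMost_iff atLeastatMost_subset_iff mult_pos_pos)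
qed

lemma flux_derivative:
  assumes "x \<in> {0..Rf'' M}"
  shows "((\<lambda>x. x * V M x) has_real_derivative lambda_f M x) (at x within {0..Rf'' M})"
  using V_C2(1)[OF assms] unfolding lambda_f_def
  by (auto intro!: derivative_eq_intros)

lemma lambda_f_pos: "x \<in> {0..Rf'' M} \<Longrightarrow> 0 < lambda_f M x"
  using V_cond(2) unfolding lambda_f_def by auto

lemma continuous_lambda_f: "continuous_on {0..Rf'' M} (lambda_f M)"
  unfolding lambda_f_def by (intro continuous_intros continuous_V continuous_V')

lemma flux_less: "0 \<le> x \<Longrightarrow> x < y \<Longrightarrow> y \<le> Rf'' M \<Longrightarrow> x * V M x < y * V M y"
  using mean_value_within[of x y "{0..Rf'' M}" "\<lambda>x. x * V M x" "lambda_f M"] flux_derivative lambda_f_pos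
  by (smt (verit, best) atLeastAtMost_iff atLeastatMost_subset_iff mult_pos_pos)

lemma curve_flux_derivative:
  assumes "0 < x"
  shows "((\<lambda>x. x * (w - p M x)) has_real_derivative w - p M x - x * p' M x) (at x within S)"
  using p_C2(1)[OF assms]
  by (auto intro!: derivative_eq_intros intro: has_field_derivative_at_within)

text \<open>
  The slope of the flux \<open>\<rho> (w - p \<rho>)\<close> along the curve, which is
  \<open>lambda_1\<close> there, has derivative \<open>-(2 p' + \<rho> p'')\<close>.
\<close>

lemma curve_speed_less:
  assumes "0 < x" "x < y"
  shows "w - p M y - y * p' M y < w - p M x - x * p' M x"
proof -
  have "((\<lambda>x. w - p M x - x * p' M x) has_real_derivative - (2 * p' M z + z * p'' M z)) (at z within {0<..})"
    if "z \<in> {0<..}" for z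
    using p_C2(1,2)[of z] that
    by (auto intro!: derivative_eq_intros intro: has_field_derivative_at_within)
  note deriv = this
  have "{x..y} \<subseteq> {0<..}" using assms by auto
  from mean_value_within[OF assms(2) this deriv]
  obtain z where "x < z" "w - p M y - y * p' M y - (w - p M x - x * p' M x)
      = (y - x) * - (2 * p' M z + z * p'' M z)" by blast
  moreover have "0 < (y - x) * (2 * p' M z + z * p'' M z)"
    using p_cond(2)[of z] assms \<open>x < z\<close> by auto
  ultimately show ?thesis by linarith
qed

text \<open>
  At the free state of density \<open>r\<close> on the curve the slope is \<open>V - \<rho> p' <
  0\<close>, and it decreases from there on.
\<close>

lemma free_curve_speed_neg:
  assumes "Rf' M \<le> r" "r \<le> Rf'' M" "V M r + p M r = w" "r \<le> x"
  shows "w - p M x - x * p' M x < 0"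
proof -
  have "w - p M r - r * p' M r < 0" using Vp_cond(2)[of r] assms by auto
  then show ?thesis using curve_speed_less[of r x w] assms Rf by (cases "r = x") auto
qed

lemma curve_flux_less:
  assumes "Rf' M \<le> r" "r \<le> Rf'' M" "V M r + p M r = w" "r \<le> x" "x < y"
  shows "y * (w - p M y) < x * (w - p M x)"
proof -
  have "\<exists>z. x < z \<and> z < y \<and> y * (w - p M y) - x * (w - p M x) = (y - x) * (w - p M z - z * p' M z)"
    using assms Rf by (intro mean_value_within[where S="{0<..}"] curve_flux_derivative) auto
  then obtain z where z: "x < z" "z < y"
    "y * (w - p M y) - x * (w - p M x) = (y - x) * (w - p M z - z * p' M z)" by blast
  moreover have "(y - x) * (w - p M z - z * p' M z) < 0"
    using free_curve_speed_neg[OF assms(1-3), of z] assms z by (intro mult_pos_neg) auto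
  ultimately show ?thesis by linarith
qed

lemma Wc_less_Wmax: "Wc M < Wmax M"
  unfolding Wc_def Wmax_def Vmin_def using V_plus_p_less[of "Rf' M" "Rf'' M"] Rf by auto

text \<open>
  The function \<open>\<rho> (Wmax - p \<rho>)\<close> is concave with negative slope at
  \<open>Rf''\<close>, so it lies below a descending line and is eventually nonpositive; there
  \<open>p\<close> exceeds \<open>Wmax\<close>.
\<close>

lemma p_reaches_Wmax: "\<exists>x\<ge>Rf'' M. p M x = Wmax M"
proof -
  define s where "s = Wmax M - p M (Rf'' M) - Rf'' M * p' M (Rf'' M)"
  have s: "s < 0" unfolding s_def
    using free_curve_speed_neg[of "Rf'' M" "Wmax M" "Rf'' M"] Rf by (auto simp: Wmax_def Vmin_def)
  \<comment> \<open>the zero of the tangent at \<open>Rf''\<close>, which starts there at height \<open>Rf'' Vmin\<close> with slope \<open>s\<close>\<close>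
  define x where "x = Rf'' M + Rf'' M * Vmin M / (- s)"
  have pos: "0 < Rf'' M" "0 < Vmin M" using Rf V_end_pos by (auto simp: Vmin_def)
  have x: "Rf'' M < x" unfolding x_def using pos s by (simp add: divide_pos_neg)
  have "\<exists>z. Rf'' M < z \<and> z < x \<and>
     x * (Wmax M - p M x) - Rf'' M * (Wmax M - p M (Rf'' M)) = (x - Rf'' M) * (Wmax M - p M z - z * p' M z)"
    using x pos by (intro mean_value_within[where S="{0<..}"] curve_flux_derivative) auto
  then obtain z where z: "Rf'' M < z"
     "x * (Wmax M - p M x) - Rf'' M * (Wmax M - p M (Rf'' M)) = (x - Rf'' M) * (Wmax M - p M z - z * p' M z)"
    by blast
  have "(x - Rf'' M) * (Wmax M - p M z - z * p' M z) \<le> (x - Rf'' M) * s"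
    using x z(1) curve_speed_less[of "Rf'' M" z "Wmax M"] pos unfolding s_def
    by (intro mult_left_mono) auto
  also have "\<dots> = - Rf'' M * Vmin M" using s by (simp add: x_def)
  finally have "x * (Wmax M - p M x) \<le> 0" using z(2) by (simp add: Wmax_def)
  then have "Wmax M \<le> p M x" using x pos by (simp add: mult_le_0_iff)
  moreover have "p M (Rf'' M) \<le> Wmax M" using pos by (simp add: Wmax_def)
  moreover have "continuous_on {Rf'' M..x} (p M)"
    by (rule continuous_on_subset[OF continuous_p]) (use pos in auto)
  ultimately show ?thesis using IVT'[of "p M" "Rf'' M" "Wmax M" x] x by fastforce
qed

lemma p_p_inv:
  assumes "p M (Rf' M) \<le> y" "y \<le> Wmax M"
  shows "Rf' M \<le> p_inv M y" "p M (p_inv M y) = y" "p_inv M y \<le> Rmax M"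
proof -
  obtain x where x: "x \<ge> Rf'' M" "p M x = Wmax M" using p_reaches_Wmax by blast
  have "continuous_on {Rf' M..x} (p M)"
    by (rule continuous_on_subset[OF continuous_p]) (use Rf in auto)
  then obtain z where z: "Rf' M \<le> z" "z \<le> x" "p M z = y"
    using IVT'[of "p M" "Rf' M" y x] assms x Rf by auto
  then have "p_inv M y = z" using p_inv_p[of z] Rf by auto
  moreover have "Rmax M = x" unfolding Rmax_def using p_inv_p[of x] x Rf by auto
  ultimately show "Rf' M \<le> p_inv M y" "p M (p_inv M y) = y" "p_inv M y \<le> Rmax M" using z by auto
qed

lemma Vc_le_V: "0 \<le> x \<Longrightarrow> x \<le> Rf'' M \<Longrightarrow> Vc M \<le> V M x"
  using V_antimono[of x "Rf'' M"] Vc_range by (auto simp: Vmin_def)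

section \<open>Curves of constant W\<close>

text \<open>
  The bounds on the speed in \<open>Omega_f\<close> follow from the monotonicity of
  \<open>V\<close>.
\<close>

lemma mem_Omega_f: "u \<in> Omega_f M \<longleftrightarrow> fst u \<in> {0..Rf'' M} \<and> snd u = V M (fst u)"
  unfolding Omega_f_def Vmin_def Vmax_def
  by (cases u) (auto intro: V_antimono)

text \<open>
  On the rectangle \<open>[0, Vc] \<times> [Wc, Wmax]\<close> the value \<open>w - v\<close> lies
  between \<open>p(Rf')\<close> and \<open>Wmax\<close>, where \<open>p_inv\<close> inverts
  \<open>p\<close>, and the bounds on the density in \<open>Omega_c\<close> come for free.
\<close>

lemma curve_state_congested:
  assumes "0 \<le> v" "v \<le> Vc M" "Wc M \<le> w" "w \<le> Wmax M"
  shows "curve_state M v w \<in> Omega_c M" "W M (curve_state M v w) = w"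
    "Rf' M \<le> fst (curve_state M v w)" "p M (fst (curve_state M v w)) = w - v"
proof -
  have *: "p M (Rf' M) \<le> w - v" "w - v \<le> Wmax M"
    using assms Vc_le_V[of "Rf' M"] Rf unfolding Wc_def by auto
  note ** = p_p_inv[OF *]
  show 1: "curve_state M v w \<in> Omega_c M"
    unfolding Omega_c_def curve_state_def using ** assms by auto
  show "W M (curve_state M v w) = w" using 1 ** unfolding W_def by (simp add: curve_state_def)
  show "Rf' M \<le> fst (curve_state M v w)" "p M (fst (curve_state M v w)) = w - v"
    using ** by (auto simp: curve_state_def)
qed

lemma snd_curve_state [simp]: "snd (curve_state M v w) = v"
  by (simp add: curve_state_def)

lemma W_congested: "u \<in> Omega_c M \<Longrightarrow> W M u = snd u + p M (fst u)"
  by (simp add: W_def)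

lemma Omega_cD:
  assumes "u \<in> Omega_c M"
  shows "Rf' M \<le> fst u" "0 \<le> snd u" "snd u \<le> Vc M" "Wc M \<le> W M u" "W M u \<le> Wmax M"
    "u = curve_state M (snd u) (W M u)"
proof -
  show "Rf' M \<le> fst u" "0 \<le> snd u" "snd u \<le> Vc M" "Wc M \<le> W M u" "W M u \<le> Wmax M"
    using assms unfolding W_congested[OF assms] by (auto simp: Omega_c_def)
  then show "u = curve_state M (snd u) (W M u)"
    using p_inv_p[of "fst u"] Rf unfolding W_congested[OF assms] curve_state_def by auto
qed

lemma free_state_exists:
  assumes "Wc M \<le> w" "w \<le> Wmax M"
  shows "\<exists>r. Rf' M \<le> r \<and> r \<le> Rf'' M \<and> V M r + p M r = w"
proof -
  have "continuous_on {Rf' M..Rf'' M} (\<lambda>x. V M x + p M x)"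
    by (intro continuous_intros continuous_on_subset[OF continuous_p] continuous_on_subset[OF continuous_V])
      (use Rf in auto)
  then show ?thesis
    using IVT'[of "\<lambda>x. V M x + p M x" "Rf' M" w "Rf'' M"] assms Rf
    by (auto simp: Wc_def Wmax_def Vmin_def add.commute)
qed

lemma u_f_eqI:
  assumes "Rf' M \<le> r" "r \<le> Rf'' M" "V M r + p M r = w"
  shows "u_f M w = (r, V M r)"
  unfolding u_f_def
proof (rule the_equality)
  show "(r, V M r) \<in> Omega_f'' M \<and> snd (r, V M r) = V M (fst (r, V M r)) \<and> snd (r, V M r) = w - p M (fst (r, V M r))"
    using assms Rf by (auto simp: Omega_f''_def mem_Omega_f)
next
  fix u assume u: "u \<in> Omega_f'' M \<and> snd u = V M (fst u) \<and> snd u = w - p M (fst u)"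
  then have "Rf' M \<le> fst u" "fst u \<le> Rf'' M" by (auto simp: Omega_f''_def mem_Omega_f)
  then have "fst u = r" using V_plus_p_less[of "fst u" r] V_plus_p_less[of r "fst u"] assms u
    by (metis add_diff_cancel_right' diff_add_cancel linorder_neqE_linordered_idom order_less_irrefl)
  then show "u = (r, V M r)" using u by (metis prod.collapse)
qed

lemma W_free:
  assumes "u \<in> Omega_f M" "Rf' M \<le> fst u"
  shows "W M u = V M (fst u) + p M (fst u)" "u_f M (W M u) = u"
proof -
  have u: "fst u \<le> Rf'' M" "snd u = V M (fst u)" using assms by (auto simp: mem_Omega_f)
  show *: "W M u = V M (fst u) + p M (fst u)"
    using assms u by (auto simp: W_def Omega_f''_def)
  show "u_f M (W M u) = u"
    using u_f_eqI[of "fst u" "W M u"] assms(2) u * by (metis prod.collapse)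
qed

lemma W_free_low:
  assumes "u \<in> Omega_f M" "fst u < Rf' M"
  shows "W M u = Wc M" "u \<notin> Omega_c M"
  using assms Omega_cD(1)[of u] by (auto simp: W_def Omega_f''_def)

lemma u_f:
  assumes "Wc M \<le> w" "w \<le> Wmax M"
  shows "u_f M w \<in> Omega_f M" "Rf' M \<le> fst (u_f M w)" "W M (u_f M w) = w"
proof -
  obtain r where r: "Rf' M \<le> r" "r \<le> Rf'' M" "V M r + p M r = w"
    using free_state_exists[OF assms] by blast
  have *: "u_f M w = (r, V M r)" using u_f_eqI[OF r] .
  show "u_f M w \<in> Omega_f M" "Rf' M \<le> fst (u_f M w)"
    unfolding * using r Rf by (auto simp: mem_Omega_f)
  then show "W M (u_f M w) = w" using W_free[of "u_f M w"] r * by auto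
qed

lemma W_range:
  assumes "u \<in> Omega M" shows "Wc M \<le> W M u" "W M u \<le> Wmax M"
proof -
  have "Wc M \<le> W M u \<and> W M u \<le> Wmax M"
  proof (cases "u \<in> Omega_c M")
    case True then show ?thesis using Omega_cD by auto
  next
    case False
    then have f: "u \<in> Omega_f M" using assms by (auto simp: Omega_def)
    show ?thesis
    proof (cases "fst u < Rf' M")
      case True then show ?thesis using W_free_low f Wc_less_Wmax by auto
    next
      case False
      then have "Rf' M \<le> fst u" "fst u \<le> Rf'' M" using f by (auto simp: mem_Omega_f)
      then show ?thesis using W_free(1)[OF f] V_plus_p_less[of "Rf' M" "fst u"] V_plus_p_less[of "fst u" "Rf'' M"]
        unfolding Wc_def Wmax_def Vmin_def by (cases "Rf' M = fst u"; cases "fst u = Rf'' M") auto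
    qed
  qed
  then show "Wc M \<le> W M u" "W M u \<le> Wmax M" by auto
qed

lemma Omega_fI: "u \<in> Omega_f M \<Longrightarrow> u \<in> Omega M" and Omega_cI: "u \<in> Omega_c M \<Longrightarrow> u \<in> Omega M"
  by (auto simp: Omega_def)

text \<open>
  On one curve of constant \<open>W\<close>, extended by its free state, higher density means lower
  speed, lower flux and lower \<open>lambda_1\<close>. This is the monotonicity on which all wave
  speeds and all comparisons of fluxes rest.
\<close>

lemma curve_order:
  assumes u1: "u1 \<in> Omega_c M \<or> u1 \<in> Omega_f M \<and> Rf' M \<le> fst u1"
    and u2: "u2 \<in> Omega_c M \<or> u2 \<in> Omega_f M \<and> Rf' M \<le> fst u2"
    and weq: "W M u1 = W M u2" and less: "fst u1 < fst u2"
  shows "snd u2 < snd u1" "Q u2 < Q u1" "lambda_1 M u2 < lambda_1 M u1" "lambda_1 M u2 < 0"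
proof -
  define w where "w = W M u1"
  have s1: "snd u1 = w - p M (fst u1)" "Rf' M \<le> fst u1"
    using u1 W_congested[of u1] W_free[of u1] Omega_cD(1)[of u1] by (auto simp: w_def mem_Omega_f)
  have s2: "snd u2 = w - p M (fst u2)"
    using u2 W_congested[of u2] W_free[of u2] by (auto simp: w_def weq mem_Omega_f)
  obtain r where r: "Rf' M \<le> r" "r \<le> Rf'' M" "V M r + p M r = w"
    using free_state_exists[of w] W_range[of u1] u1 Omega_fI Omega_cI unfolding w_def by blast
  have "r \<le> fst u1"
  proof (cases "u1 \<in> Omega_c M")
    case True
    then have "p M r \<le> p M (fst u1)" using Omega_cD(3)[of u1] Vc_le_V[of r] r s1 Rf by auto
    then show ?thesis using p_le_iff[of r "fst u1"] r s1 Rf by auto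
  next
    case False
    then have "u_f M w = u1" using W_free u1 w_def by auto
    then show ?thesis using u_f_eqI[OF r] by auto
  qed
  note * = this
  have pos: "0 < fst u1" using s1 Rf by auto
  show "snd u2 < snd u1" using s1 s2 p_less[OF pos less] by auto
  show "Q u2 < Q u1" unfolding Q_def s1 s2 by (rule curve_flux_less[OF r * less])
  show "lambda_1 M u2 < lambda_1 M u1" unfolding lambda_1_def s1 s2 by (rule curve_speed_less[OF pos less])
  show "lambda_1 M u2 < 0" unfolding lambda_1_def s2 using free_curve_speed_neg[OF r, of "fst u2"] * less by auto
qed

lemma u_c_eq: "u_c M w = curve_state M (Vc M) w"
  by (simp add: u_c_def curve_state_def)

lemma u_m_eq: "u_m M ul ur = curve_state M (snd ur) (W M ul)"
  by (simp add: u_m_def curve_state_def)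

lemma congested_eqI:
  assumes "u1 \<in> Omega_c M" "u2 \<in> Omega_c M" "W M u1 = W M u2" "fst u1 = fst u2 \<or> snd u1 = snd u2"
  shows "u1 = u2"
proof -
  have "snd u1 = snd u2" using assms W_congested by fastforce
  then show ?thesis using Omega_cD(6) assms by metis
qed

lemma curve_state_less:
  assumes "0 \<le> v1" "v1 < v2" "v2 \<le> Vc M" "Wc M \<le> w" "w \<le> Wmax M"
  shows "fst (curve_state M v2 w) < fst (curve_state M v1 w)"
    "Q (curve_state M v1 w) < Q (curve_state M v2 w)"
    "lambda_1 M (curve_state M v1 w) < lambda_1 M (curve_state M v2 w)"
proof -
  have c1: "0 \<le> v1" "v1 \<le> Vc M" and c2: "0 \<le> v2" "v2 \<le> Vc M" using assms by auto
  note 1 = curve_state_congested[OF c1 assms(4,5)] and 2 = curve_state_congested[OF c2 assms(4,5)]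
  show *: "fst (curve_state M v2 w) < fst (curve_state M v1 w)"
    using p_less_iff[of "fst (curve_state M v2 w)" "fst (curve_state M v1 w)"] 1 2 assms Rf by auto
  show "Q (curve_state M v1 w) < Q (curve_state M v2 w)"
    "lambda_1 M (curve_state M v1 w) < lambda_1 M (curve_state M v2 w)"
    using curve_order[of "curve_state M v2 w" "curve_state M v1 w"] 1 2 * by auto
qed

lemma Q_curve_state_mono_speed:
  assumes "0 \<le> v1" "v1 \<le> v2" "v2 \<le> Vc M" "Wc M \<le> w" "w \<le> Wmax M"
  shows "Q (curve_state M v1 w) \<le> Q (curve_state M v2 w)"
  using curve_state_less(2)[of v1 v2 w] assms by (cases "v1 = v2") auto

lemma Q_curve_state_mono_W:
  assumes "0 \<le> v" "v \<le> Vc M" "Wc M \<le> w1" "w1 \<le> w2" "w2 \<le> Wmax M"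
  shows "Q (curve_state M v w1) \<le> Q (curve_state M v w2)"
proof -
  have "fst (curve_state M v w1) \<le> fst (curve_state M v w2)"
    using curve_state_congested[of v w1] curve_state_congested[of v w2] assms Rf
      p_le_iff[of "fst (curve_state M v w1)" "fst (curve_state M v w2)"] by auto
  then show ?thesis unfolding Q_def using assms by (simp add: mult_right_mono)
qed

text \<open>
  Every congested state lies to the right of the free state of its curve.
\<close>

lemma lambda_1_neg:
  assumes "u \<in> Omega_c M" shows "lambda_1 M u < 0"
proof -
  note u = Omega_cD[OF assms]
  obtain r where r: "Rf' M \<le> r" "r \<le> Rf'' M" "V M r + p M r = W M u"
    using free_state_exists[OF u(4,5)] by blast
  have "p M r \<le> p M (fst u)" using u(3) Vc_le_V[of r] r Rf W_congested[OF assms] by auto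
  then have "r \<le> fst u" using p_le_iff[of r "fst u"] r u Rf by auto
  from free_curve_speed_neg[OF r this] show ?thesis
    unfolding lambda_1_def W_congested[OF assms] by simp
qed

text \<open>
  Together the two inequalities say that the transition from a congested state to \<open>u_f\<close>
  moves to the left.
\<close>

lemma Q_congested_less_u_f:
  assumes "u \<in> Omega_c M" "u \<noteq> u_f M (W M u)"
  shows "fst (u_f M (W M u)) < fst u" "Q u < Q (u_f M (W M u))"
proof -
  note u = Omega_cD[OF assms(1)]
  note f = u_f[OF u(4,5)]
  have f': "W M u = V M (fst (u_f M (W M u))) + p M (fst (u_f M (W M u)))"
    "snd (u_f M (W M u)) = V M (fst (u_f M (W M u)))" "fst (u_f M (W M u)) \<le> Rf'' M"
    using W_free(1)[OF f(1,2)] f by (auto simp: mem_Omega_f)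
  have "p M (fst (u_f M (W M u))) \<le> p M (fst u)"
    using f' u(3) Vc_le_V[of "fst (u_f M (W M u))"] f(2) Rf W_congested[OF assms(1)] by auto
  then have "fst (u_f M (W M u)) \<le> fst u"
    using p_le_iff[of "fst (u_f M (W M u))" "fst u"] f u Rf by auto
  moreover have "fst (u_f M (W M u)) \<noteq> fst u"
    using assms(2) f' W_congested[OF assms(1)] by (metis add_right_cancel prod_eqI)
  ultimately show *: "fst (u_f M (W M u)) < fst u" by auto
  show "Q u < Q (u_f M (W M u))" using curve_order(2)[of "u_f M (W M u)" u] assms f * by auto
qed

lemma Q_congested_le_u_f: "u \<in> Omega_c M \<Longrightarrow> Q u \<le> Q (u_f M (W M u))"
  using Q_congested_less_u_f(2)[of u] by (cases "u = u_f M (W M u)") auto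

lemma Q_free_less:
  assumes "u1 \<in> Omega_f M" "u2 \<in> Omega_f M" "fst u1 < fst u2" shows "Q u1 < Q u2"
  using assms flux_less[of "fst u1" "fst u2"] unfolding Q_def mem_Omega_f by auto

lemma Q_free_le_iff:
  assumes "u1 \<in> Omega_f M" "u2 \<in> Omega_f M" shows "Q u1 \<le> Q u2 \<longleftrightarrow> fst u1 \<le> fst u2"
proof -
  have "fst u1 = fst u2 \<Longrightarrow> Q u1 = Q u2" using assms by (auto simp: mem_Omega_f Q_def)
  then show ?thesis using Q_free_less[of u1 u2] Q_free_less[of u2 u1] assms
    by (metis leD leI linorder_le_less_linear order_le_less)
qed

lemma free_eqI:
  assumes "u1 \<in> Omega_f M" "u2 \<in> Omega_f M" "Q u1 = Q u2 \<or> fst u1 = fst u2" shows "u1 = u2"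
proof -
  have "fst u1 = fst u2" using assms Q_free_le_iff[of u1 u2] Q_free_le_iff[of u2 u1] by auto
  then show ?thesis using assms by (auto simp: mem_Omega_f intro: prod_eqI)
qed

text \<open>
  For a density below \<open>Rf'\<close> the value of \<open>W\<close> is \<open>Wc\<close>, and
  \<open>u_f Wc\<close> is the free state of density \<open>Rf'\<close>; the free flux increases
  with the density.
\<close>

lemma Q_free_le_u_f:
  assumes "u \<in> Omega_f M" shows "Q u \<le> Q (u_f M (W M u))"
proof (cases "fst u < Rf' M")
  case True
  then have "W M u = Wc M" using W_free_low assms by auto
  then show ?thesis using u_f[of "Wc M"] Wc_less_Wmax Q_free_le_iff[OF assms, of "u_f M (Wc M)"] True by auto
next
  case False
  then show ?thesis using W_free(2)[OF assms] by auto
qed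

lemma free_state_with_flux:
  assumes "0 \<le> q" "q \<le> qmax M" obtains u where "u \<in> Omega_f M" "Q u = q"
proof -
  have "continuous_on {0..Rf'' M} (\<lambda>x. x * V M x)"
    by (intro continuous_intros continuous_V)
  then obtain x where "0 \<le> x" "x \<le> Rf'' M" "x * V M x = q"
    using IVT'[of "\<lambda>x. x * V M x" 0 q "Rf'' M"] assms Rf by (auto simp: qmax_def Vmin_def)
  then have "(x, V M x) \<in> Omega_f M" "Q (x, V M x) = q" by (auto simp: mem_Omega_f Q_def)
  then show thesis by (rule that)
qed

lemma curve_state_of_density:
  assumes "0 < x" shows "curve_state M (w - p M x) w = (x, w - p M x)"
  using p_inv_p[OF assms] by (simp add: curve_state_def)

text \<open>
  Intermediate values along the curve, parametrised by the density so that continuity of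
  \<open>p_inv\<close> does not enter.
\<close>

lemma speed_with_flux:
  assumes "0 \<le> v" "v \<le> Vc M" "Wc M \<le> w" "w \<le> Wmax M" "0 \<le> q" "q \<le> Q (curve_state M v w)"
  obtains v' where "0 \<le> v'" "v' \<le> v" "Q (curve_state M v' w) = q"
proof -
  define x1 where "x1 = fst (curve_state M v w)"
  define x2 where "x2 = fst (curve_state M 0 w)"
  have c0: "0 \<le> (0::real)" "0 \<le> Vc M" using Vc_range by auto
  note 1 = curve_state_congested[OF assms(1-4)] and 2 = curve_state_congested[OF c0 assms(3,4)]
  have pos: "0 < x1" "0 < x2" using 1(3) 2(3) Rf by (auto simp: x1_def x2_def)
  have "x1 \<le> x2" using p_le_iff[of x1 x2] pos 1 2 assms by (auto simp: x1_def x2_def)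
  moreover have "continuous_on {x1..x2} (\<lambda>x. x * (w - p M x))"
    by (intro continuous_intros continuous_on_subset[OF continuous_p]) (use pos in auto)
  ultimately obtain x where x: "x1 \<le> x" "x \<le> x2" "x * (w - p M x) = q"
    using IVT2'[of "\<lambda>x. x * (w - p M x)" x2 q x1] assms 1 2
    by (auto simp: x1_def x2_def Q_def mult.commute)
  have "p M x1 \<le> p M x" "p M x \<le> p M x2" using x pos p_le_iff by auto
  then have "0 \<le> w - p M x" "w - p M x \<le> v" using 1 2 by (auto simp: x1_def x2_def)
  moreover have "Q (curve_state M (w - p M x) w) = q"
    using curve_state_of_density[of x w] x pos by (simp add: Q_def)
  ultimately show thesis by (rule that)
qed

text \<open>
  With the speed fixed, the density is \<open>q / v\<close>, which fixes \<open>w\<close>.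
\<close>

lemma W_with_flux:
  assumes "0 < v" "v \<le> Vc M" "Wc M \<le> w1" "w1 \<le> w2" "w2 \<le> Wmax M"
    "Q (curve_state M v w1) \<le> q" "q \<le> Q (curve_state M v w2)"
  obtains w where "w1 \<le> w" "w \<le> w2" "Q (curve_state M v w) = q"
proof -
  note 1 = curve_state_congested[of v w1] and 2 = curve_state_congested[of v w2]
  have "fst (curve_state M v w1) \<le> q / v" "q / v \<le> fst (curve_state M v w2)"
    using assms by (auto simp: Q_def field_simps)
  then have "p M (fst (curve_state M v w1)) \<le> p M (q / v)" "p M (q / v) \<le> p M (fst (curve_state M v w2))" "0 < q / v"
    using p_le_iff assms 1 2 Rf by (smt (verit))+
  then have "w1 \<le> v + p M (q / v)" "v + p M (q / v) \<le> w2"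
    "Q (curve_state M v (v + p M (q / v))) = q"
    using 1 2 assms curve_state_of_density[of "q/v" "v + p M (q / v)"] by (auto simp: Q_def)
  then show thesis by (rule that)
qed

section \<open>The overlap of the two phases\<close>

text \<open>
  A common state has speed at least \<open>Vmin\<close> as a free state and at most
  \<open>Vc\<close> as a congested one.
\<close>

lemma overlap:
  assumes "u \<in> Omega_f M" "u \<in> Omega_c M"
  shows "snd u = Vc M" "Vc M = Vmin M" "u = u_f M (W M u)"
proof -
  have "V M (fst u) \<le> Vc M" "Vmin M \<le> V M (fst u)" "snd u = V M (fst u)"
    using assms Omega_cD[OF assms(2)] V_antimono[of "fst u" "Rf'' M"] by (auto simp: mem_Omega_f Vmin_def)
  then show "snd u = Vc M" "Vc M = Vmin M" using Vc_range by auto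
  show "u = u_f M (W M u)" using W_free(2) Omega_cD(1) assms by simp
qed

text \<open>
  If the phases meet below the density \<open>Rf''\<close>, then \<open>V\<close> is constant on an
  interval ending at \<open>Rf''\<close>, so \<open>V'\<close> vanishes at \<open>Rf''\<close>.
  Since \<open>\<rho>\<^sup>2 V'(\<rho>)\<close> is nonincreasing, \<open>V'\<close> is then
  nonnegative, hence zero, at all smaller positive densities.
\<close>

lemma overlap_V_const:
  assumes "u \<in> Omega_f M" "u \<in> Omega_c M" "fst u < Rf'' M" "0 < x" "x \<le> Rf'' M"
  shows "V M x = Vc M" "V' M x = 0"
proof -
  have u: "0 \<le> fst u" "V M (fst u) = Vmin M" using overlap[OF assms(1,2)] assms(1) by (auto simp: mem_Omega_f)
  have const: "V M z = Vmin M" if "fst u \<le> z" "z \<le> Rf'' M" for z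
    using V_antimono[of "fst u" z] V_antimono[of z "Rf'' M"] u that by (auto simp: Vmin_def)
  have V'0: "V' M z = 0" if z: "fst u < z" "z < Rf'' M" for z
  proof -
    have "(V M has_real_derivative V' M z) (at z within {fst u<..<Rf'' M})"
      using V_C2(1)[of z] z u by (auto intro: has_field_derivative_subset)
    then have "(V M has_real_derivative V' M z) (at z)" using z by (simp add: at_within_open[of z "{fst u<..<Rf'' M}"])
    moreover have "((\<lambda>z. Vmin M) has_real_derivative V' M z) (at z)"
      by (rule has_field_derivative_transform_within_open[OF calculation, of "{fst u<..<Rf'' M}"])
        (use z in \<open>auto simp: const\<close>)
    ultimately show ?thesis using DERIV_unique[OF _ DERIV_const] by blast
  qed
  \<comment> \<open>by continuity of \<open>V'\<close> at the end point\<close>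
  have V'_b: "V' M (Rf'' M) = 0"
  proof -
    have "V' M constant_on closure {fst u<..<Rf'' M}"
      by (intro constant_on_closureI)
        (use u assms V'0 in \<open>auto simp: constant_on_def intro!: continuous_on_subset[OF continuous_V']\<close>)
    then have "V' M constant_on {fst u..Rf'' M}" using assms by simp
    then have "V' M (Rf'' M) = V' M ((fst u + Rf'' M) / 2)"
      using assms by (auto simp: constant_on_def)
    then show ?thesis using V'0[of "(fst u + Rf'' M) / 2"] assms by auto
  qed
  have V'0: "V' M y = 0" if y: "0 < y" "y \<le> Rf'' M" for y
  proof (cases "y = Rf'' M")
    case False
    have "((\<lambda>x. x^2 * V' M x) has_real_derivative z * (2 * V' M z + z * V'' M z)) (at z within {0..Rf'' M})"
      if "z \<in> {0..Rf'' M}" for z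
      using V_C2(2)[OF that] by (auto intro!: derivative_eq_intros simp: power2_eq_square algebra_simps)
    from mean_value_within[OF _ _ this, of y "Rf'' M"] y False obtain z where
      z: "y < z" "z < Rf'' M" "- (y^2 * V' M y) = (Rf'' M - y) * (z * (2 * V' M z + z * V'' M z))"
      using V'_b by auto
    have "(Rf'' M - y) * (z * (2 * V' M z + z * V'' M z)) \<le> 0"
      using z y V_cond(3)[of z] by (intro mult_nonneg_nonpos) auto
    then have "0 \<le> y^2 * V' M y" using z by linarith
    then show ?thesis using V_cond(1)[of y] y by (auto simp: zero_le_mult_iff)
  qed (use V'_b in auto)
  then show "V' M x = 0" using assms by auto
  show "V M x = Vc M"
    using mean_value_within[of x "Rf'' M" "{0..Rf'' M}" "V M" "V' M"] assms V'0 V_C2(1) overlap(2)[OF assms(1,2)]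
    by (cases "x = Rf'' M") (auto simp: Vmin_def)
qed

section \<open>Waves of the Riemann solver\<close>

text \<open>
  All waves of the free phase have positive speed.
\<close>

lemma R_LWR_at_nonpos:
  assumes "ul \<in> Omega_f M" "ur \<in> Omega_f M" "x \<le> 0"
  shows "R_LWR M ul ur x = ul"
proof -
  consider "fst ul < fst ur" | "fst ul = fst ur" | "fst ur < fst ul" by linarith
  then show ?thesis
  proof cases
    case 1
    then have "0 < sigma ul ur" using Q_free_less[OF assms(1,2)] unfolding sigma_def by simp
    then show ?thesis using 1 assms(3) by (simp add: R_LWR_def)
  next
    case 2
    then have "ul = ur" using free_eqI assms by blast
    then show ?thesis by (simp add: R_LWR_def)
  next
    case 3
    then show ?thesis using lambda_f_pos[of "fst ul"] assms by (simp add: R_LWR_def mem_Omega_f)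
  qed
qed

lemma R_LWR_at_right:
  assumes "ul \<in> Omega_f M" "ur \<in> Omega_f M"
  shows "\<forall>\<^sub>F x in at_right 0. R_LWR M ul ur x = ul"
proof -
  consider "fst ul < fst ur" | "fst ul = fst ur" | "fst ur < fst ul" by linarith
  then show ?thesis
  proof cases
    case 1
    then have "0 < sigma ul ur" using Q_free_less[OF assms(1,2)] unfolding sigma_def by simp
    then show ?thesis using 1
      unfolding eventually_at_right_field by (intro exI[of _ "sigma ul ur"]) (simp add: R_LWR_def)
  next
    case 2
    then have "ul = ur" using free_eqI assms by blast
    then show ?thesis by (simp add: R_LWR_def)
  next
    case 3
    then show ?thesis using lambda_f_pos[of "fst ul"] assms
      unfolding eventually_at_right_field
      by (intro exI[of _ "lambda_f M (fst ul)"]) (simp add: R_LWR_def mem_Omega_f)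
  qed
qed

lemma R_LWR_mem:
  assumes "ul \<in> Omega_f M" "ur \<in> Omega_f M"
  shows "R_LWR M ul ur x \<in> Omega_f M"
proof (cases "fst ur < fst ul \<and> lambda_f M (fst ul) \<le> x \<and> x < lambda_f M (fst ur)")
  case True
  define S where "S = {\<rho> \<in> {fst ur..fst ul}. lambda_f M \<rho> = x}"
  have d: "0 \<le> fst ur" "fst ul \<le> Rf'' M" using assms by (auto simp: mem_Omega_f)
  have cont: "continuous_on {fst ur..fst ul} (lambda_f M)"
    by (rule continuous_on_subset[OF continuous_lambda_f]) (use d in auto)
  have "S \<noteq> {}" using IVT2'[of "lambda_f M" "fst ul" x "fst ur"] True cont by (auto simp: S_def)
  moreover have "S \<subseteq> {fst ur..fst ul}" by (auto simp: S_def)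
  ultimately have "fst ur \<le> Inf S" "Inf S \<le> fst ul"
    by (auto intro!: cInf_greatest) (meson atLeastAtMost_iff bdd_below.I cInf_lower2 ex_in_conv subsetD)
  then show ?thesis using True d by (auto simp: R_LWR_def mem_Omega_f S_def Let_def)
next
  case False
  then show ?thesis using assms by (auto simp: R_LWR_def)
qed

lemma R_LWR_shock: "fst ul \<le> fst ur \<Longrightarrow> R_LWR M ul ur x = ul \<or> R_LWR M ul ur x = ur"
  by (simp add: R_LWR_def)

text \<open>
  Where \<open>V\<close> is constant, so is \<open>lambda_f\<close>, and the rarefaction degenerates
  to one jump.
\<close>

lemma R_LWR_overlap:
  assumes "ul \<in> Omega_f M \<inter> Omega_c M" "ur \<in> Omega_f M \<inter> Omega_c M"
  shows "R_LWR M ul ur x = ul \<or> R_LWR M ul ur x = ur"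
proof (cases "fst ul \<le> fst ur")
  case False
  have d: "0 < fst ur" "fst ul \<le> Rf'' M" "0 < fst ul"
    using assms Omega_cD(1)[of ur] Rf False by (auto simp: mem_Omega_f)
  then have "lambda_f M (fst ul) = lambda_f M (fst ur)"
    using overlap_V_const[of ur "fst ul"] overlap_V_const[of ur "fst ur"] assms False
    by (auto simp: lambda_f_def)
  then show ?thesis by (simp add: R_LWR_def)
qed (rule R_LWR_shock)

lemma R1_free: "ul \<in> Omega_f M \<Longrightarrow> ur \<in> Omega_f M \<Longrightarrow> R1 M ul ur = R_LWR M ul ur"
  by (auto simp: R1_def)

lemma wave_1_trivial: "wave_1 M u u x = u"
  by (simp add: wave_1_def)

text \<open>
  For a rarefaction, the intermediate value theorem for \<open>lambda_1\<close> along the curve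
  provides the state inside the fan, and \<open>curve_order\<close> its uniqueness.
\<close>

lemma wave_1_mem:
  assumes ul: "ul \<in> Omega_c M" and v: "0 \<le> v" "v \<le> Vc M"
  shows "\<exists>v'. min (snd ul) v \<le> v' \<and> v' \<le> max (snd ul) v \<and>
    wave_1 M ul (curve_state M v (W M ul)) x = curve_state M v' (W M ul)"
proof -
  define w where "w = W M ul"
  define um where "um = curve_state M v w"
  note l = Omega_cD[OF ul, folded w_def]
  note m = curve_state_congested[OF v l(4,5), folded um_def]
  show ?thesis
  proof (cases "snd ul < v \<and> lambda_1 M ul \<le> x \<and> x < lambda_1 M um")
    case True
    have less: "fst um < fst ul"
      using curve_state_less(1)[of "snd ul" v w] l v True by (simp add: um_def)
    have pos: "0 < fst um" using m Rf by auto
    have pl: "p M (fst ul) = w - snd ul" using W_congested[OF ul] by (simp add: w_def)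
    have "continuous_on {fst um..fst ul} (\<lambda>y. w - p M y - y * p' M y)"
      by (intro continuous_intros continuous_on_subset[OF continuous_p] continuous_on_subset[OF continuous_p'])
        (use pos in auto)
    then obtain y where y: "fst um \<le> y" "y \<le> fst ul" "w - p M y - y * p' M y = x"
      using IVT2'[of "\<lambda>y. w - p M y - y * p' M y" "fst ul" x "fst um"] True less m pl
      by (auto simp: lambda_1_def um_def)
    define v' where "v' = w - p M y"
    have "p M (fst um) \<le> p M y" "p M y \<le> p M (fst ul)" using y pos p_le_iff by auto
    then have v': "snd ul \<le> v'" "v' \<le> v" using m pl by (auto simp: v'_def)
    have y_eq: "curve_state M v' w = (y, v')"
      unfolding v'_def using curve_state_of_density[of y w] y pos by auto
    have v'': "0 \<le> v'" "v' \<le> Vc M" using v' l v by auto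
    note c = curve_state_congested[OF v'' l(4,5)]
    have lam: "lambda_1 M (curve_state M v' w) = x"
      using y(3) unfolding lambda_1_def y_eq by (simp add: v'_def)
    have "(THE u. u \<in> Omega_c M \<and> W M u = w \<and> lambda_1 M u = x) = curve_state M v' w"
    proof (rule the_equality)
      show "curve_state M v' w \<in> Omega_c M \<and> W M (curve_state M v' w) = w \<and> lambda_1 M (curve_state M v' w) = x"
        using c lam by simp
    next
      fix u assume u: "u \<in> Omega_c M \<and> W M u = w \<and> lambda_1 M u = x"
      have "fst u = fst (curve_state M v' w)"
        using curve_order(3)[of u "curve_state M v' w"] curve_order(3)[of "curve_state M v' w" u] u c lam
        by fastforce
      then show "u = curve_state M v' w" using congested_eqI u c by auto
    qed
    then have "wave_1 M ul um x = curve_state M v' w"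
      using True by (simp add: wave_1_def w_def um_def)
    then show ?thesis using v' True unfolding um_def w_def by (intro exI[of _ v']) auto
  next
    case False
    then have "wave_1 M ul um x = ul \<or> wave_1 M ul um x = um"
      by (auto simp: wave_1_def um_def)
    then show ?thesis using l(6) unfolding um_def w_def
      by (metis max.cobounded1 max.cobounded2 min.cobounded1 min.cobounded2)
  qed
qed

text \<open>
  The speed of a shock and the fastest speed \<open>lambda_1\<close> of a rarefaction are negative,
  so the profile is constant from some negative position on.
\<close>

lemma wave_1_near_zero:
  assumes ul: "ul \<in> Omega_c M" and v: "0 \<le> v" "v \<le> Vc M"
  shows "\<exists>e>0. \<forall>x>-e. wave_1 M ul (curve_state M v (W M ul)) x = curve_state M v (W M ul)"
proof -
  define w where "w = W M ul"
  define um where "um = curve_state M v w"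
  note l = Omega_cD[OF ul, folded w_def]
  note m = curve_state_congested[OF v l(4,5), folded um_def]
  consider "snd ul < v" | "v = snd ul" | "v < snd ul" by linarith
  then show ?thesis
  proof cases
    case 1
    then have "\<forall>x> - (- lambda_1 M um). wave_1 M ul um x = um"
      using curve_state_less(3)[of "snd ul" v w] l v by (auto simp: wave_1_def um_def)
    then show ?thesis using lambda_1_neg[OF m(1)] unfolding um_def w_def
      by (intro exI[of _ "- lambda_1 M um"]) (auto simp: um_def w_def)
  next
    case 2
    then have "um = ul" using l(6) by (simp add: um_def)
    then show ?thesis using wave_1_trivial[of ul] by (auto simp: um_def w_def intro: exI[of _ 1])
  next
    case 3
    then have "fst ul < fst um" "Q um < Q ul"
      using curve_state_less(1,2)[of v "snd ul" w] l v by (auto simp: um_def)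
    then have "sigma ul um < 0" by (simp add: sigma_def divide_neg_pos)
    moreover have "\<forall>x>sigma ul um. wave_1 M ul um x = um"
      using 3 by (auto simp: wave_1_def um_def)
    ultimately show ?thesis by (intro exI[of _ "- sigma ul um"]) (auto simp: um_def w_def)
  qed
qed

lemma R1_congested:
  assumes "ul \<in> Omega_c M" "ur \<in> Omega_c M" "\<not> (ul \<in> Omega_f M \<and> ur \<in> Omega_f M)"
  shows "R1 M ul ur x = (if x < snd ur then wave_1 M ul (curve_state M (snd ur) (W M ul)) x else ur)"
  using assms by (auto simp: R1_def R_ARZ_def u_m_eq)

lemma u_m_overlap:
  assumes "ul \<in> Omega_f M \<inter> Omega_c M" "ur \<in> Omega_f M \<inter> Omega_c M"
  shows "curve_state M (snd ur) (W M ul) = ul" "snd ul = snd ur"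
  using assms overlap(1)[of ul] overlap(1)[of ur] Omega_cD(6)[of ul] by auto

text \<open>
  Here the states may also be free: on the overlap the wave is a single jump, and \<open>ul\<close>
  is the state of its own curve with speed \<open>snd ur\<close>.
\<close>

lemma R1_congested_mem:
  assumes ul: "ul \<in> Omega_c M" and ur: "ur \<in> Omega_c M"
  shows "R1 M ul ur x = ur \<or> (\<exists>v. min (snd ul) (snd ur) \<le> v \<and> v \<le> max (snd ul) (snd ur) \<and>
    R1 M ul ur x = curve_state M v (W M ul))"
proof (cases "ul \<in> Omega_f M \<and> ur \<in> Omega_f M")
  case True
  then have "R1 M ul ur x = ul \<or> R1 M ul ur x = ur"
    using R_LWR_overlap[of ul ur x] assms R1_free[of ul ur] by auto
  then show ?thesis using Omega_cD(6)[OF ul]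
    by (metis max.cobounded1 min.cobounded1)
next
  case False
  then show ?thesis using R1_congested[OF ul ur False, of x] wave_1_mem[OF ul, of "snd ur" x]
      Omega_cD[OF ur] by auto
qed

lemma R1_congested_left:
  assumes ul: "ul \<in> Omega_c M" and ur: "ur \<in> Omega_c M"
  shows "Lim (at_left 0) (R1 M ul ur) = curve_state M (snd ur) (W M ul)"
proof (rule Lim_eventually_eq)
  show "\<forall>\<^sub>F x in at_left 0. R1 M ul ur x = curve_state M (snd ur) (W M ul)"
  proof (cases "ul \<in> Omega_f M \<and> ur \<in> Omega_f M")
    case True
    then show ?thesis using R_LWR_at_nonpos[of ul ur] u_m_overlap(1)[of ul ur] assms R1_free[of ul ur]
      by (auto intro: eventually_at_leftI[of "-1"])
  next
    case False
    obtain e where "e > 0" "\<forall>x>-e. wave_1 M ul (curve_state M (snd ur) (W M ul)) x = curve_state M (snd ur) (W M ul)"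
      using wave_1_near_zero[OF ul] Omega_cD[OF ur] by blast
    then show ?thesis using R1_congested[OF ul ur False] Omega_cD(2)[OF ur]
      by (auto intro!: eventually_at_leftI[of "-e"])
  qed
qed simp

lemma R1_congested_right:
  assumes ul: "ul \<in> Omega_c M" and ur: "ur \<in> Omega_c M"
  shows "Lim (at_right 0) (R1 M ul ur) = (if 0 < snd ur then curve_state M (snd ur) (W M ul) else ur)"
proof (rule Lim_eventually_eq)
  show "\<forall>\<^sub>F x in at_right 0. R1 M ul ur x = (if 0 < snd ur then curve_state M (snd ur) (W M ul) else ur)"
  proof (cases "ul \<in> Omega_f M \<and> ur \<in> Omega_f M")
    case True
    then have "0 < snd ur" using overlap(1)[of ur] ur Vc_range by auto
    then show ?thesis using R_LWR_at_right[of ul ur] u_m_overlap(1)[of ul ur] assms R1_free[of ul ur] True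
      by auto
  next
    case False
    obtain e where "e > 0" "\<forall>x>-e. wave_1 M ul (curve_state M (snd ur) (W M ul)) x = curve_state M (snd ur) (W M ul)"
      using wave_1_near_zero[OF ul] Omega_cD[OF ur] by blast
    then have "\<forall>\<^sub>F x in at_right 0. R1 M ul ur x = curve_state M (snd ur) (W M ul)" if "0 < snd ur"
      using R1_congested[OF ul ur False] that by (auto intro!: eventually_at_rightI[of _ "snd ur"])
    moreover have "\<forall>\<^sub>F x in at_right 0. R1 M ul ur x = ur" if "snd ur = 0"
      using R1_congested[OF ul ur False] that by (auto intro!: eventually_at_rightI[of _ 1])
    ultimately show ?thesis using Omega_cD(2)[OF ur] by auto
  qed
qed simp

lemma R1_free_congested:
  assumes "ul \<in> Omega_f M" "ul \<notin> Omega_c M" "ur \<in> Omega_c M" "ur \<notin> Omega_f M"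
  shows "R1 M ul ur x =
    (if x < sigma ul (curve_state M (snd ur) (W M ul)) then ul
     else if x < snd ur then curve_state M (snd ur) (W M ul) else ur)"
proof -
  have "W M (curve_state M (snd ur) (W M ul)) = W M ul"
    using curve_state_congested(2)[of "snd ur" "W M ul"] Omega_cD[OF assms(3)] W_range[OF Omega_fI[OF assms(1)]] by auto
  then show ?thesis using assms by (simp add: R1_def R_ARZ_def u_m_eq wave_1_trivial)
qed

lemma R1_free_congested_mem:
  assumes "ul \<in> Omega_f M" "ur \<in> Omega_c M" "ur \<notin> Omega_f M"
  shows "R1 M ul ur x \<in> {ul, curve_state M (snd ur) (W M ul), ur}"
proof (cases "ul \<in> Omega_c M")
  case True
  have "snd ur \<le> snd ul" using overlap(1)[OF assms(1) True] Omega_cD[OF assms(2)] by simp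
  then show ?thesis using R1_congested[OF True assms(2)] assms by (simp add: wave_1_def)
qed (use assms R1_free_congested[of ul ur x] in auto)

text \<open>
  A transition from a state that is only free is thus a genuine jump, and the direction in which it
  moves is determined by the two fluxes.
\<close>

lemma free_before_congested:
  assumes "ul \<in> Omega_f M" "ul \<notin> Omega_c M" "0 \<le> v" "v \<le> Vc M"
  shows "fst ul < fst (curve_state M v (W M ul))"
proof -
  note w = W_range[OF Omega_fI[OF assms(1)]]
  note m = curve_state_congested[OF assms(3,4) w]
  show ?thesis
  proof (cases "fst ul < Rf' M")
    case False
    then have "u_f M (W M ul) = ul" using W_free(2) assms by auto
    moreover have "curve_state M v (W M ul) \<noteq> ul" using m(1) assms(2) by metis
    ultimately show ?thesis using Q_congested_less_u_f(1)[OF m(1)] m(2) by simp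
  qed (use m in auto)
qed

lemma sigma_sign:
  assumes "fst ul < fst um"
  shows "0 < sigma ul um \<longleftrightarrow> Q ul < Q um" "sigma ul um < 0 \<longleftrightarrow> Q um < Q ul"
  using assms by (auto simp: sigma_def zero_less_divide_iff divide_less_0_iff)

lemma R1_free_congested_left:
  assumes "ul \<in> Omega_f M" "ul \<notin> Omega_c M" "ur \<in> Omega_c M" "ur \<notin> Omega_f M"
  defines "um \<equiv> curve_state M (snd ur) (W M ul)"
  shows "Lim (at_left 0) (R1 M ul ur) = (if Q um < Q ul then um else ul)"
proof (rule Lim_eventually_eq)
  note v = Omega_cD(2,3)[OF assms(3)]
  have less: "fst ul < fst um" unfolding um_def using free_before_congested assms v by blast
  show "\<forall>\<^sub>F x in at_left 0. R1 M ul ur x = (if Q um < Q ul then um else ul)"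
  proof (cases "Q um < Q ul")
    case True
    then show ?thesis using R1_free_congested[OF assms(1-4), folded um_def] sigma_sign[OF less] v
      by (auto intro!: eventually_at_leftI[of "sigma ul um"])
  next
    case False
    then show ?thesis using R1_free_congested[OF assms(1-4), folded um_def] sigma_sign[OF less] v
      by (auto intro!: eventually_at_leftI[of "-1"])
  qed
qed simp

lemma R1_free_congested_right:
  assumes "ul \<in> Omega_f M" "ul \<notin> Omega_c M" "ur \<in> Omega_c M" "ur \<notin> Omega_f M"
  defines "um \<equiv> curve_state M (snd ur) (W M ul)"
  shows "Lim (at_right 0) (R1 M ul ur) = (if Q ul < Q um then ul else if 0 < snd ur then um else ur)"
proof (rule Lim_eventually_eq)
  note v = Omega_cD(2,3)[OF assms(3)]
  have less: "fst ul < fst um" unfolding um_def using free_before_congested assms v by blast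
  show "\<forall>\<^sub>F x in at_right 0. R1 M ul ur x = (if Q ul < Q um then ul else if 0 < snd ur then um else ur)"
  proof -
    note profile = R1_free_congested[OF assms(1-4), folded um_def] sigma_sign[OF less] v
    consider "Q ul < Q um" | "\<not> Q ul < Q um" "0 < snd ur" | "\<not> Q ul < Q um" "snd ur = 0"
      using v by linarith
    then show ?thesis
    proof cases
      case 1
      then show ?thesis using profile by (auto intro!: eventually_at_rightI[of _ "sigma ul um"])
    next
      case 2
      then show ?thesis using profile by (auto intro!: eventually_at_rightI[of _ "snd ur"])
    next
      case 3
      then show ?thesis using profile by (auto intro!: eventually_at_rightI[of _ 1])
    qed
  qed
qed simp

lemma R1_congested_free:
  assumes "ul \<in> Omega_c M" "ul \<notin> Omega_f M" "ur \<in> Omega_f M" "ur \<notin> Omega_c M"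
  shows "R1 M ul ur x =
    (if x < sigma (u_c M (W M ul)) (u_f M (W M ul)) then
       (if x < Vc M then wave_1 M ul (u_c M (W M ul)) x else u_c M (W M ul))
     else R_LWR M (u_f M (W M ul)) ur x)"
  using assms by (simp add: R1_def R_ARZ_def u_m_eq Let_def u_c_eq)

lemma u_c_facts:
  assumes "Wc M \<le> w" "w \<le> Wmax M"
  shows "u_c M w \<in> Omega_c M" "W M (u_c M w) = w" "snd (u_c M w) = Vc M"
  using curve_state_congested[of "Vc M" w] Vc_range assms by (auto simp: u_c_eq)

text \<open>
  The degenerate transition, with speed zero by the convention on \<open>sigma\<close>, occurs if
  the curve of \<open>w\<close> meets the overlap of the phases.
\<close>

lemma sigma_u_c_u_f:
  assumes "Wc M \<le> w" "w \<le> Wmax M"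
  shows "u_c M w = u_f M w \<and> sigma (u_c M w) (u_f M w) = 0 \<or> sigma (u_c M w) (u_f M w) < 0"
proof (cases "u_c M w = u_f M w")
  case False
  then have "fst (u_f M w) < fst (u_c M w)" "Q (u_c M w) < Q (u_f M w)"
    using Q_congested_less_u_f[of "u_c M w"] u_c_facts[OF assms] by auto
  then show ?thesis by (simp add: sigma_def divide_pos_neg)
qed (simp add: sigma_def)

lemma R1_congested_free_mem:
  assumes "ul \<in> Omega_c M" "ul \<notin> Omega_f M" "ur \<in> Omega_f M" "ur \<notin> Omega_c M"
  shows "R1 M ul ur x \<in> Omega_f M \<or>
    (\<exists>v. snd ul \<le> v \<and> v \<le> Vc M \<and> R1 M ul ur x = curve_state M v (W M ul))"
proof -
  note l = Omega_cD[OF assms(1)]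
  have "\<exists>v. snd ul \<le> v \<and> v \<le> Vc M \<and> wave_1 M ul (u_c M (W M ul)) x = curve_state M v (W M ul)"
    using wave_1_mem[OF assms(1), of "Vc M" x] Vc_range l by (auto simp: u_c_eq)
  then show ?thesis
    using R1_congested_free[OF assms, of x] R_LWR_mem[OF u_f(1)[OF l(4,5)] assms(3), of x] l
      u_c_eq[of "W M ul"] by auto
qed

lemma R1_congested_free_left:
  assumes "ul \<in> Omega_c M" "ul \<notin> Omega_f M" "ur \<in> Omega_f M" "ur \<notin> Omega_c M"
  shows "Lim (at_left 0) (R1 M ul ur) = u_f M (W M ul)"
proof (rule Lim_eventually_eq)
  note l = Omega_cD[OF assms(1)]
  obtain e where e: "e > 0" "\<forall>x>-e. wave_1 M ul (u_c M (W M ul)) x = u_c M (W M ul)"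
    using wave_1_near_zero[OF assms(1), of "Vc M"] Vc_range by (auto simp: u_c_eq)
  show "\<forall>\<^sub>F x in at_left 0. R1 M ul ur x = u_f M (W M ul)"
    using sigma_u_c_u_f[OF l(4,5)]
  proof
    assume "u_c M (W M ul) = u_f M (W M ul) \<and> sigma (u_c M (W M ul)) (u_f M (W M ul)) = 0"
    then show ?thesis using R1_congested_free[OF assms] e Vc_range
      by (auto intro!: eventually_at_leftI[of "-e"])
  next
    assume "sigma (u_c M (W M ul)) (u_f M (W M ul)) < 0"
    then show ?thesis using R1_congested_free[OF assms] R_LWR_at_nonpos[OF u_f(1)[OF l(4,5)] assms(3)]
      by (auto intro!: eventually_at_leftI[of "sigma (u_c M (W M ul)) (u_f M (W M ul))"])
  qed
qed simp

lemma R1_congested_free_right: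
  assumes "ul \<in> Omega_c M" "ul \<notin> Omega_f M" "ur \<in> Omega_f M" "ur \<notin> Omega_c M"
  shows "Lim (at_right 0) (R1 M ul ur) = u_f M (W M ul)"
proof (rule Lim_eventually_eq)
  note l = Omega_cD[OF assms(1)]
  have "sigma (u_c M (W M ul)) (u_f M (W M ul)) \<le> 0" using sigma_u_c_u_f[OF l(4,5)] by auto
  then have "\<forall>\<^sub>F x in at_right 0. R1 M ul ur x = R_LWR M (u_f M (W M ul)) ur x"
    using R1_congested_free[OF assms] by (auto intro!: eventually_at_rightI[of _ 1])
  with R_LWR_at_right[OF u_f(1)[OF l(4,5)] assms(3)]
  show "\<forall>\<^sub>F x in at_right 0. R1 M ul ur x = u_f M (W M ul)"
    by eventually_elim simp
qed simp

lemma R1_free_left: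
  assumes "ul \<in> Omega_f M" "ur \<in> Omega_f M" shows "Lim (at_left 0) (R1 M ul ur) = ul"
  by (rule Lim_eventually_eq)
    (auto intro!: eventually_at_leftI[of "-1"] simp: R1_free R_LWR_at_nonpos assms)

lemma R1_free_right:
  assumes "ul \<in> Omega_f M" "ur \<in> Omega_f M" shows "Lim (at_right 0) (R1 M ul ur) = ul"
  by (rule Lim_eventually_eq) (auto simp: R1_free R_LWR_at_right assms)

section \<open>The flux at the origin\<close>

text \<open>
  The one-sided limits at the origin may differ, by a stationary jump, but their fluxes agree; see
  \<open>trace_flux_left\<close>.
\<close>

definition trace_flux :: "state \<Rightarrow> state \<Rightarrow> real" where
  "trace_flux ul ur = Q (Lim (at_right 0) (R1 M ul ur))"

lemma trace_flux_free: "ul \<in> Omega_f M \<Longrightarrow> ur \<in> Omega_f M \<Longrightarrow> trace_flux ul ur = Q ul"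
  by (simp add: trace_flux_def R1_free_right)

lemma trace_flux_congested:
  "ul \<in> Omega_c M \<Longrightarrow> ur \<in> Omega_c M \<Longrightarrow> trace_flux ul ur = Q (curve_state M (snd ur) (W M ul))"
  using Omega_cD(2)[of ur] by (auto simp: trace_flux_def R1_congested_right Q_def)

text \<open>
  The transition moves to the right exactly if the left flux is the smaller one, so the smaller flux
  is the one observed at the origin. On the overlap the left state has the largest flux of its
  curve, and the formula remains valid.
\<close>

lemma trace_flux_free_congested:
  assumes "ul \<in> Omega_f M" "ur \<in> Omega_c M" "ur \<notin> Omega_f M"
  shows "trace_flux ul ur = min (Q ul) (Q (curve_state M (snd ur) (W M ul)))"
proof (cases "ul \<in> Omega_c M")
  case True
  then have "Q (curve_state M (snd ur) (W M ul)) \<le> Q (curve_state M (Vc M) (W M ul))"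
    "curve_state M (Vc M) (W M ul) = ul"
    using Q_curve_state_mono_speed[of "snd ur" "Vc M" "W M ul"] Omega_cD[OF True] Omega_cD[OF assms(2)] overlap(1)[OF assms(1) True]
    by auto
  then show ?thesis using trace_flux_congested[OF True assms(2)] by simp
next
  case False
  then show ?thesis using R1_free_congested_right[OF assms(1) False assms(2,3)] Omega_cD(2)[OF assms(2)]
    by (auto simp: trace_flux_def Q_def)
qed

lemma trace_flux_congested_free:
  assumes "ul \<in> Omega_c M" "ul \<notin> Omega_f M" "ur \<in> Omega_f M" "ur \<notin> Omega_c M"
  shows "trace_flux ul ur = Q (u_f M (W M ul))"
  using R1_congested_free_right[OF assms] by (simp add: trace_flux_def)

lemma trace_flux_left:
  assumes "ul \<in> Omega M" "ur \<in> Omega M"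
  shows "Q (Lim (at_left 0) (R1 M ul ur)) = trace_flux ul ur"
proof -
  consider "ul \<in> Omega_f M \<and> ur \<in> Omega_f M" | "ul \<in> Omega_c M \<and> ur \<in> Omega_c M"
    | "ul \<in> Omega_f M \<and> ul \<notin> Omega_c M \<and> ur \<in> Omega_c M \<and> ur \<notin> Omega_f M"
    | "ul \<in> Omega_c M \<and> ul \<notin> Omega_f M \<and> ur \<in> Omega_f M \<and> ur \<notin> Omega_c M"
    using assms by (auto simp: Omega_def)
  then show ?thesis
    by cases (auto simp: trace_flux_free R1_free_left trace_flux_congested R1_congested_left trace_flux_free_congested
      R1_free_congested_left trace_flux_congested_free R1_congested_free_left)
qed

text \<open>
  Since the two fluxes at the origin agree, \<open>C1\<close> and \<open>N1\<close> are
  complementary.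
\<close>

lemma mem_C1: "(ul, ur) \<in> C1 M \<longleftrightarrow> ul \<in> Omega M \<and> ur \<in> Omega M \<and> trace_flux ul ur \<le> Q0 M"
  using trace_flux_left[of ul ur] by (auto simp: C1_def trace_flux_def)

lemma mem_N1: "(ul, ur) \<in> N1 M \<longleftrightarrow> ul \<in> Omega M \<and> ur \<in> Omega M \<and> trace_flux ul ur > Q0 M"
  using trace_flux_left[of ul ur] by (auto simp: N1_def trace_flux_def)

lemma congested_eq_of_flux:
  assumes "u1 \<in> Omega_c M" "u2 \<in> Omega_c M" "W M u1 = W M u2" "Q u1 = Q u2"
  shows "u1 = u2"
proof -
  have "fst u1 = fst u2" using curve_order(2)[of u1 u2] curve_order(2)[of u2 u1] assms by fastforce
  then show ?thesis using congested_eqI assms by auto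
qed

lemma N1_upstream_free:
  assumes "(ul, ur) \<in> N1 M" "ul \<in> Omega_f M" shows "Q0 M < Q ul"
  using assms trace_flux_free[of ul ur] trace_flux_free_congested[of ul ur]
  by (cases "ur \<in> Omega_f M") (auto simp: mem_N1 Omega_def)

text \<open>
  The state \<open>u_f\<close> has the largest flux on its curve.
\<close>

lemma trace_flux_le_u_f:
  assumes "ul \<in> Omega M" "ur \<in> Omega M" shows "trace_flux ul ur \<le> Q (u_f M (W M ul))"
proof -
  note w = W_range[OF assms(1)]
  consider "ul \<in> Omega_f M" "ur \<in> Omega_f M" | "ul \<in> Omega_f M" "ur \<in> Omega_c M" "ur \<notin> Omega_f M"
    | "ul \<in> Omega_c M" "ur \<in> Omega_c M" | "ul \<in> Omega_c M" "ul \<notin> Omega_f M" "ur \<in> Omega_f M" "ur \<notin> Omega_c M"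
    using assms by (auto simp: Omega_def)
  then show ?thesis
  proof cases
    case 1 then show ?thesis using trace_flux_free[of ul ur] Q_free_le_u_f[of ul] by simp
  next
    case 2 then show ?thesis using trace_flux_free_congested[of ul ur] Q_free_le_u_f[of ul] by simp
  next
    case 3
    then show ?thesis using trace_flux_congested[of ul ur] curve_state_congested[of "snd ur" "W M ul"] Omega_cD[of ur] w
        Q_congested_le_u_f[of "curve_state M (snd ur) (W M ul)"] by simp
  next
    case 4 then show ?thesis using trace_flux_congested_free[of ul ur] by simp
  qed
qed

section \<open>The traces of the constrained solver\<close>

text \<open>
  The flux through the origin in a constrained problem: the constraint \<open>Q0\<close>, unless the
  curve of the left state cannot carry that much in the congested phase.
\<close>

definition hat_flux :: "state \<Rightarrow> real" where
  "hat_flux ul = min (Q0 M) (Q (u_c M (W M ul)))"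

lemma hat_flux_pos: "ul \<in> Omega M \<Longrightarrow> 0 < hat_flux ul"
  using u_c_facts[of "W M ul"] W_range[of ul] Omega_cD(1)[of "u_c M (W M ul)"] Rf Vc_range Q0_range
  by (auto simp: hat_flux_def Q_def)

text \<open>
  In particular a congested right state of a constrained problem is not at rest: otherwise the flux
  at the origin would be zero.
\<close>

lemma N1_downstream_congested:
  assumes "(ul, ur) \<in> N1 M" "ur \<in> Omega_c M"
  shows "hat_flux ul \<le> Q (curve_state M (snd ur) (W M ul))" "0 < snd ur"
proof -
  have N: "ul \<in> Omega M" "Q0 M < trace_flux ul ur" using assms by (auto simp: mem_N1)
  consider "ul \<in> Omega_c M" | "ul \<in> Omega_f M" "ur \<notin> Omega_f M" | "ur \<in> Omega_f M"
    using N(1) by (auto simp: Omega_def)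
  then show *: "hat_flux ul \<le> Q (curve_state M (snd ur) (W M ul))"
  proof cases
    case 1 then show ?thesis using trace_flux_congested[of ul ur] assms N by (simp add: hat_flux_def)
  next
    case 2 then show ?thesis using trace_flux_free_congested[of ul ur] assms N
      by (simp add: hat_flux_def min_le_iff_disj)
  next
    case 3 then show ?thesis using overlap(1)[of ur] assms by (simp add: hat_flux_def u_c_eq)
  qed
  then have "0 < Q (curve_state M (snd ur) (W M ul))" using hat_flux_pos[OF N(1)] by linarith
  then show "0 < snd ur" using Omega_cD(2)[OF assms(2)] by (cases "snd ur = 0") (auto simp: Q_def)
qed

text \<open>
  From a congested left state one reaches \<open>h\<close> by a 1-wave. From a free one, the
  transition to \<open>h\<close> moves to the left since \<open>Q h \<le> Q0 < Q ul\<close>.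
\<close>

lemma hat_left_trace:
  assumes "(ul, ur) \<in> N1 M" "h \<in> Omega_c M" "W M h = W M ul" "Q h \<le> Q0 M"
  shows "Lim (at_left 0) (R1 M ul h) = h"
proof (cases "ul \<in> Omega_c M")
  case True
  then show ?thesis using R1_congested_left[OF True assms(2)] Omega_cD(6)[OF assms(2)] assms(3) by simp
next
  case False
  then have f: "ul \<in> Omega_f M" using assms(1) by (auto simp: mem_N1 Omega_def)
  have less: "Q h < Q ul" using N1_upstream_free[OF assms(1) f] assms by simp
  have "h \<notin> Omega_f M"
  proof
    assume "h \<in> Omega_f M"
    then have "h = u_f M (W M ul)" using overlap(3)[OF _ assms(2)] assms(3) by simp
    then show False using Q_free_le_u_f[OF f] less by simp
  qed
  then show ?thesis using R1_free_congested_left[OF f False assms(2)] less Omega_cD(6)[OF assms(2)] assms(3) by simp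
qed

text \<open>
  The candidates for the downstream trace \<open>c\<close>, given its flux. To the left of a
  congested state of speed \<open>v\<close>, a flux below that of \<open>(v, Wc)\<close> is too
  small for a congested state of speed \<open>v\<close>, and it is carried by a free state of
  density below \<open>Rf'\<close>, from which a transition moves to the right.
\<close>

definition downstream_choice :: "state \<Rightarrow> state \<Rightarrow> bool" where
  "downstream_choice ur c \<longleftrightarrow>
     (if ur \<in> Omega_c M then
        if Q c < Q (curve_state M (snd ur) (Wc M)) then c \<in> Omega_f M \<and> fst c < Rf' M
        else c \<in> Omega_c M \<and> snd c = snd ur
      else c \<in> Omega_f M)"

lemma downstream_choice_Omega: "downstream_choice ur c \<Longrightarrow> c \<in> Omega M"
  by (auto simp: downstream_choice_def Omega_def split: if_splits)

lemma check_right_trace: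
  assumes "ur \<in> Omega M" "ur \<in> Omega_c M \<Longrightarrow> 0 < snd ur" "downstream_choice ur c"
  shows "Lim (at_right 0) (R1 M c ur) = c"
proof -
  consider "ur \<in> Omega_f M" "c \<in> Omega_f M" | "ur \<in> Omega_c M" "c \<in> Omega_c M" "snd c = snd ur"
    | "ur \<in> Omega_c M" "ur \<notin> Omega_f M" "c \<in> Omega_f M" "fst c < Rf' M" "Q c < Q (curve_state M (snd ur) (Wc M))"
    using assms(1,3) by (auto simp: downstream_choice_def Omega_def split: if_splits)
  then show ?thesis
  proof cases
    case 1 then show ?thesis by (rule R1_free_right[rotated])
  next
    case 2 then show ?thesis using R1_congested_right[of c ur] Omega_cD(6)[of c] assms(2) by simp
  next
    case 3
    then show ?thesis using R1_free_congested_right[of c ur] W_free_low[of c] by simp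
  qed
qed

text \<open>
  A congested trace next to a congested state has the speed of that state, hence a flux of at least
  that of \<open>(v, Wc)\<close>; a trace that is only free, next to a state that is only congested,
  has a flux below that of \<open>(v, w)\<close>, which forces its density below \<open>Rf'\<close>.
  These cases exclude each other, and in each of them the flux determines the state. Only a right
  state in both phases leaves two candidates, which is the situation of the tie-break in
  \<open>cond_B\<close>.
\<close>

lemma check_unique:
  assumes ur: "ur \<in> Omega M" "ur \<in> Omega_c M \<Longrightarrow> 0 < snd ur" and c: "downstream_choice ur c"
    and c': "c' \<in> Omega M" "Lim (at_right 0) (R1 M c' ur) = c'" and eq: "Q c' = Q c"
  shows "c' = c \<or> Vc M = Vmin M \<and> c \<in> Omega_c M \<and> c' \<notin> Omega_c M"
proof (cases "ur \<in> Omega_c M")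
  case False
  then have f: "ur \<in> Omega_f M" "c \<in> Omega_f M" using ur c by (auto simp: downstream_choice_def Omega_def)
  have "c' \<in> Omega_f M"
  proof (rule ccontr)
    assume n: "c' \<notin> Omega_f M"
    then have "c' \<in> Omega_c M" using c' by (auto simp: Omega_def)
    then have "u_f M (W M c') = c'" using R1_congested_free_right[OF _ n f(1) False] c' by simp
    then show False using u_f(1)[OF W_range[OF c'(1)]] n by simp
  qed
  then show ?thesis using free_eqI f eq by blast
next
  case True
  define q where "q = Q (curve_state M (snd ur) (Wc M))"
  note r = Omega_cD[OF True] and r0 = ur(2)[OF True]
  \<comment> \<open>\<open>q\<close> separates the fluxes of congested from those of free candidates\<close>
  have low_or_high: "c' \<in> Omega_c M \<and> snd c' = snd ur \<and> q \<le> Q c'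
    \<or> c' \<in> Omega_f M \<and> c' \<notin> Omega_c M \<and> (ur \<in> Omega_f M \<or> Q c' < q)"
  proof (cases "c' \<in> Omega_c M")
    case T: True
    then have *: "c' = curve_state M (snd ur) (W M c')"
      using R1_congested_right[OF T True] c'(2) r0 by simp
    then have "snd c' = snd ur" by (metis snd_curve_state)
    moreover have "q \<le> Q c'" unfolding q_def
      by (subst *) (use Q_curve_state_mono_W[of "snd ur" "Wc M" "W M c'"] r Omega_cD[OF T] in auto)
    ultimately show ?thesis using T by simp
  next
    case F: False
    then have f: "c' \<in> Omega_f M" using c' by (auto simp: Omega_def)
    have "Q c' < q" if n: "ur \<notin> Omega_f M"
    proof -
      define um where "um = curve_state M (snd ur) (W M c')"
      have um: "um \<in> Omega_c M" "W M um = W M c'"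
        unfolding um_def using curve_state_congested W_range[OF c'(1)] r by auto
      have "Q c' < Q um"
        using R1_free_congested_right[OF f F True n] c'(2) F True r0 um unfolding um_def[symmetric]
        by (metis)
      moreover have "Q um \<le> Q (u_f M (W M c'))" using Q_congested_le_u_f um by fastforce
      ultimately have "u_f M (W M c') \<noteq> c'" by auto
      then have "fst c' < Rf' M" using W_free(2)[OF f] by linarith
      then show ?thesis using \<open>Q c' < Q um\<close> W_free_low[OF f] by (simp add: um_def q_def)
    qed
    then show ?thesis using f F by auto
  qed
  show ?thesis
  proof (cases "Q c < q")
    case True
    then have "c \<in> Omega_f M" using c \<open>ur \<in> Omega_c M\<close> by (simp add: downstream_choice_def q_def)
    moreover have "c' \<in> Omega_f M" using low_or_high True eq by auto
    ultimately show ?thesis using free_eqI eq by blast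
  next
    case False
    then have cc: "c \<in> Omega_c M" "snd c = snd ur"
      using c \<open>ur \<in> Omega_c M\<close> by (auto simp: downstream_choice_def q_def)
    show ?thesis
    proof (cases "c' \<in> Omega_c M")
      case T: True
      then have s: "snd c' = snd c" using low_or_high cc by auto
      then have "fst c' = fst c" using eq r0 cc by (auto simp: Q_def)
      then show ?thesis using s by (auto intro: prod_eqI)
    next
      case F: False
      then have "ur \<in> Omega_f M" using low_or_high False eq by auto
      then show ?thesis using overlap(2) True F cc by blast
    qed
  qed
qed

lemma hat_exists:
  assumes "ul \<in> Omega M"
  obtains h where "h \<in> Omega_c M" "W M h = W M ul" "Q h = hat_flux ul"
proof -
  note w = W_range[OF assms]
  obtain v where v: "0 \<le> v" "v \<le> Vc M" "Q (curve_state M v (W M ul)) = hat_flux ul"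
    using speed_with_flux[of "Vc M" "W M ul" "hat_flux ul"] w Vc_range hat_flux_pos[OF assms]
    by (auto simp: hat_flux_def u_c_eq)
  then show thesis using that[of "curve_state M v (W M ul)"] curve_state_congested[OF v(1,2) w] by auto
qed

text \<open>
  For large fluxes the value of \<open>W\<close> is adjusted along the line of constant speed; the
  curve of the left state carries enough flux for this.
\<close>

lemma check_exists:
  assumes N: "(ul, ur) \<in> N1 M"
  obtains c where "downstream_choice ur c" "Q c = hat_flux ul"
proof -
  have O: "ul \<in> Omega M" "ur \<in> Omega M" using N by (auto simp: mem_N1)
  note w = W_range[OF O(1)]
  have "0 \<le> hat_flux ul" "hat_flux ul \<le> qmax M"
    using hat_flux_pos[OF O(1)] Q0_range by (auto simp: hat_flux_def)
  then obtain f where f: "f \<in> Omega_f M" "Q f = hat_flux ul" using free_state_with_flux by blast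
  show thesis
  proof (cases "ur \<in> Omega_c M")
    case False
    then show thesis using that[of f] f by (auto simp: downstream_choice_def)
  next
    case True
    note r = Omega_cD[OF True] and d = N1_downstream_congested[OF N True]
    show thesis
    proof (cases "hat_flux ul < Q (curve_state M (snd ur) (Wc M))")
      case less: True
      define um where "um = curve_state M (snd ur) (Wc M)"
      have um: "um \<in> Omega_c M" "W M um = Wc M"
        unfolding um_def using curve_state_congested[of "snd ur" "Wc M"] r Wc_less_Wmax by auto
      have uf: "u_f M (Wc M) = (Rf' M, V M (Rf' M))"
        using u_f_eqI[of "Rf' M" "Wc M"] Rf by (auto simp: Wc_def)
      have "Q f < Q (u_f M (Wc M))" using Q_congested_le_u_f[OF um(1)] um f less by (simp add: um_def)
      then have "fst f < Rf' M" using Q_free_le_iff[of "u_f M (Wc M)" f] f u_f(1)[of "Wc M"] Wc_less_Wmax uf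
        by (auto simp: not_le[symmetric])
      then show thesis using that[of f] f less True by (auto simp: downstream_choice_def)
    next
      case False
      obtain w' where w': "Wc M \<le> w'" "w' \<le> W M ul" "Q (curve_state M (snd ur) w') = hat_flux ul"
        using W_with_flux[of "snd ur" "Wc M" "W M ul" "hat_flux ul"] d r w False by auto
      then show thesis using that[of "curve_state M (snd ur) w'"] False True r w curve_state_congested[of "snd ur" w']
        by (auto simp: downstream_choice_def)
    qed
  qed
qed

text \<open>
  A state that is free but not congested cannot be an upstream trace: it would be the left state
  itself or \<open>u_f (W ul)\<close>, whose fluxes exceed \<open>Q0\<close> in a constrained
  problem.
\<close>

lemma cond_A_flux_le:
  assumes N: "(ul, ur) \<in> N1 M" and h: "h \<in> Omega M" and A: "cond_A M ul ur h c"
  shows "h \<in> Omega_c M" "Q h \<le> hat_flux ul"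
proof -
  have O: "ul \<in> Omega M" "ur \<in> Omega M" "Q0 M < trace_flux ul ur" using N by (auto simp: mem_N1)
  have A: "Lim (at_left 0) (R1 M ul h) = h" "Q h \<le> Q0 M" "W M h = W M ul"
    using A by (auto simp: cond_A_def)
  show 1: "h \<in> Omega_c M"
  proof (rule ccontr)
    assume n: "h \<notin> Omega_c M"
    then have f: "h \<in> Omega_f M" using h by (auto simp: Omega_def)
    show False
    proof (cases "ul \<in> Omega_f M")
      case True
      then have "h = ul" using R1_free_left[OF True f] A by simp
      then show False using N1_upstream_free[OF N True] A by simp
    next
      case False
      then have "ul \<in> Omega_c M" using O by (auto simp: Omega_def)
      then have "h = u_f M (W M ul)" using R1_congested_free_left[OF _ False f n] A by simp
      then show False using trace_flux_le_u_f[OF O(1,2)] O(3) A by simp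
    qed
  qed
  have "Q h \<le> Q (u_c M (W M h))"
    using Q_curve_state_mono_speed[of "snd h" "Vc M" "W M h"] Omega_cD[OF 1] by (simp add: u_c_eq)
  then show "Q h \<le> hat_flux ul" using A by (simp add: hat_flux_def)
qed

text \<open>
  Two pairs that both satisfy \<open>cond_B\<close> would each have to beat the other.
\<close>

lemma constraint_pair_eqI:
  assumes "h \<in> Omega_c M" "c \<in> Omega M" "cond_A M ul ur h c" "cond_B M ul ur h c"
  shows "constraint_pair M ul ur = (h, c)"
  unfolding constraint_pair_def
proof (rule the_equality)
  show "case (h, c) of (u_hat, u_check) \<Rightarrow> u_hat \<in> Omega_c M \<and> u_check \<in> Omega M \<and>
    cond_A M ul ur u_hat u_check \<and> cond_B M ul ur u_hat u_check" using assms by simp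
next
  fix z assume "case z of (u_hat, u_check) \<Rightarrow> u_hat \<in> Omega_c M \<and> u_check \<in> Omega M \<and>
    cond_A M ul ur u_hat u_check \<and> cond_B M ul ur u_hat u_check"
  then obtain h' c' where z: "z = (h', c')" "h' \<in> Omega_c M" "c' \<in> Omega M" "cond_A M ul ur h' c'" "cond_B M ul ur h' c'"
    by (cases z) auto
  then show "z = (h, c)" using assms Omega_cI[of h] Omega_cI[of h'] unfolding cond_B_def
    by (metis less_asym less_irrefl)
qed

lemma constraint_pair_description:
  assumes N: "(ul, ur) \<in> N1 M"
  obtains h c where "constraint_pair M ul ur = (h, c)" "h \<in> Omega_c M" "W M h = W M ul"
    "Q h = hat_flux ul" "Q c = hat_flux ul" "downstream_choice ur c"
proof -
  have O: "ul \<in> Omega M" "ur \<in> Omega M" using N by (auto simp: mem_N1)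
  obtain h where h: "h \<in> Omega_c M" "W M h = W M ul" "Q h = hat_flux ul" using hat_exists[OF O(1)] .
  obtain c where c: "downstream_choice ur c" "Q c = hat_flux ul" using check_exists[OF N] .
  note r0 = N1_downstream_congested(2)[OF N]
  have A: "cond_A M ul ur h c"
    using hat_left_trace[OF N h(1,2)] check_right_trace[OF O(2) r0 c(1)] h c
    by (auto simp: cond_A_def hat_flux_def)
  have "cond_B M ul ur h c"
    unfolding cond_B_def
  proof (intro ballI impI, elim conjE)
    fix h' c' assume *: "h' \<in> Omega M" "c' \<in> Omega M" "cond_A M ul ur h' c'" "(h', c') \<noteq> (h, c)"
    note h' = cond_A_flux_le[OF N *(1,3)]
    have A': "W M h' = W M ul" "Q c' = Q h'" "Lim (at_right 0) (R1 M c' ur) = c'" using *(3) by (auto simp: cond_A_def)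
    show "Q h' < Q h \<or> Vc M = Vmin M \<and> Q h' = Q h \<and> c \<in> Omega_c M \<and> c' \<notin> Omega_c M"
    proof (cases "Q h' = Q h")
      case True
      then have "h' = h" using congested_eq_of_flux[OF h'(1) h(1)] h A' by simp
      moreover have "c' = c \<or> Vc M = Vmin M \<and> c \<in> Omega_c M \<and> c' \<notin> Omega_c M"
        using check_unique[OF O(2) r0 c(1) *(2)] A' True h c by simp
      ultimately show ?thesis using * by auto
    next
      case False
      then show ?thesis using h' h by simp
    qed
  qed
  then show thesis
    using that constraint_pair_eqI[OF h(1) downstream_choice_Omega[OF c(1)] A] h c by blast
qed

lemma R1c_unconstrained: "(ul, ur) \<in> C1 M \<Longrightarrow> R1c M ul ur x = R1 M ul ur x"
  by (simp add: R1c_def)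

lemma R1c_constrained:
  assumes N: "(ul, ur) \<in> N1 M"
  obtains h c where "h \<in> Omega_c M" "W M h = W M ul" "Q h = hat_flux ul"
    "Q c = hat_flux ul" "downstream_choice ur c"
    "\<forall>x. R1c M ul ur x = (if x < 0 then R1 M ul h x else R1 M c ur x)"
proof -
  obtain h c where *: "constraint_pair M ul ur = (h, c)" "h \<in> Omega_c M" "W M h = W M ul"
    "Q h = hat_flux ul" "Q c = hat_flux ul" "downstream_choice ur c" using constraint_pair_description[OF N] .
  have "R1c M ul ur x = (if x < 0 then R1 M ul h x else R1 M c ur x)" for x
    using N *(1) by (auto simp: R1c_def mem_N1 mem_C1)
  then show thesis using that[OF *(2-)] by blast
qed

text \<open>
  On the overlap \<open>h\<close> is \<open>u_f (W ul)\<close>, which has at least the density of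
  \<open>ul\<close>, so that the free solver joins them by one shock.
\<close>

lemma upstream_profile_free:
  assumes "ul \<in> Omega_f M" "h \<in> Omega_c M" "W M h = W M ul"
  shows "R1 M ul h x = ul \<or> R1 M ul h x = h"
proof (cases "h \<in> Omega_f M")
  case True
  then have "h = u_f M (W M ul)" using overlap(3) assms by metis
  then have "fst ul \<le> fst h" using Q_free_le_u_f[OF assms(1)] Q_free_le_iff[OF assms(1) True] by simp
  then show ?thesis using R_LWR_shock[of ul h x] R1_free[OF assms(1) True] by simp
next
  case False
  then show ?thesis using R1_free_congested_mem[OF assms(1,2) False, of x] Omega_cD(6)[OF assms(2)] assms(3) by auto
qed

lemma downstream_profile_congested:
  assumes "ur \<in> Omega_c M" "downstream_choice ur c"
  shows "R1 M c ur x = c \<or> R1 M c ur x = ur \<or>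
    ur \<notin> Omega_f M \<and> R1 M c ur x = curve_state M (snd ur) (Wc M)"
proof (cases "c \<in> Omega_c M \<and> snd c = snd ur")
  case True
  then show ?thesis using R1_congested_mem[of c ur x] Omega_cD(6)[of c] assms by auto
next
  case False
  then have c: "c \<in> Omega_f M" "fst c < Rf' M" using assms by (auto simp: downstream_choice_def split: if_splits)
  show ?thesis
  proof (cases "ur \<in> Omega_f M")
    case True
    then have "R_LWR M c ur x = c \<or> R_LWR M c ur x = ur"
      using R_LWR_shock[of c ur x] Omega_cD(1)[OF assms(1)] c by simp
    then show ?thesis using R1_free c True by auto
  next
    case False
    then show ?thesis using R1_free_congested_mem[OF c(1) assms(1) False, of x] W_free_low[OF c] by auto
  qed
qed

lemma downstream_profile_free:
  assumes "ur \<in> Omega_f M" "ur \<notin> Omega_c M" "downstream_choice ur c"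
  shows "c \<in> Omega_f M" "R1 M c ur x \<in> Omega_f M"
  using assms R_LWR_mem[of c ur x] R1_free[of c ur] by (auto simp: downstream_choice_def)

section \<open>Reaching states in invariant domains\<close>

lemma R1_congested_closed:
  assumes "ul \<in> Omega_c M" "ur \<in> Omega_c M" shows "R1 M ul ur x \<in> Omega_c M"
proof -
  note l = Omega_cD[OF assms(1)] and r = Omega_cD[OF assms(2)]
  have "curve_state M v (W M ul) \<in> Omega_c M"
    if "min (snd ul) (snd ur) \<le> v" "v \<le> max (snd ul) (snd ur)" for v
    using that l r curve_state_congested(1)[of v "W M ul"] by auto
  then show ?thesis using R1_congested_mem[OF assms, of x] assms(2) by auto
qed

text \<open>
  Invariance in terms of \<open>R1\<close> alone, with the traces \<open>h\<close> and
  \<open>c\<close> known by their characterisation.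
\<close>

lemma invariant_domainI:
  assumes sub: "D \<subseteq> Omega M"
    and C: "\<And>ul ur x. ul \<in> D \<Longrightarrow> ur \<in> D \<Longrightarrow> trace_flux ul ur \<le> Q0 M \<Longrightarrow> R1 M ul ur x \<in> D"
    and N: "\<And>ul ur h c x. ul \<in> D \<Longrightarrow> ur \<in> D \<Longrightarrow> Q0 M < trace_flux ul ur \<Longrightarrow>
      h \<in> Omega_c M \<Longrightarrow> W M h = W M ul \<Longrightarrow> Q h = hat_flux ul \<Longrightarrow>
      Q c = hat_flux ul \<Longrightarrow> downstream_choice ur c \<Longrightarrow> R1 M ul h x \<in> D \<and> R1 M c ur x \<in> D"
  shows "invariant_domain M D"
  unfolding invariant_domain_def
proof (intro conjI ballI subsetI)
  fix ul ur z assume u: "ul \<in> D" "ur \<in> D" and "z \<in> range (R1c M ul ur)"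
  then obtain x where x: "z = R1c M ul ur x" by auto
  show "z \<in> D"
  proof (cases "trace_flux ul ur \<le> Q0 M")
    case True
    then have "(ul, ur) \<in> C1 M" using u sub by (auto simp: mem_C1)
    then show ?thesis using C[OF u True] x by (simp add: R1c_unconstrained)
  next
    case False
    then have "(ul, ur) \<in> N1 M" using u sub by (auto simp: mem_N1)
    obtain h c where hc: "h \<in> Omega_c M" "W M h = W M ul" "Q h = hat_flux ul"
      "Q c = hat_flux ul" "downstream_choice ur c"
      and R: "\<forall>x. R1c M ul ur x = (if x < 0 then R1 M ul h x else R1 M c ur x)"
      using R1c_constrained[OF \<open>(ul, ur) \<in> N1 M\<close>] .
    have "Q0 M < trace_flux ul ur" using False by simp
    then have "R1 M ul h x \<in> D \<and> R1 M c ur x \<in> D" by (rule N[OF u _ hc])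
    then show ?thesis using R x by simp
  qed
qed (use sub in auto)

lemma invariant_domainD:
  "invariant_domain M D \<Longrightarrow> ul \<in> D \<Longrightarrow> ur \<in> D \<Longrightarrow> R1c M ul ur x \<in> D"
  unfolding invariant_domain_def by blast

lemma curve_state_u_m:
  assumes "ul \<in> Omega M" "ur \<in> Omega_c M"
  shows "curve_state M (snd ur) (W M ul) \<in> Omega_c M" "W M (curve_state M (snd ur) (W M ul)) = W M ul"
  using curve_state_congested(1,2)[of "snd ur" "W M ul"] Omega_cD[OF assms(2)] W_range[OF assms(1)] by auto

lemma Q_u_m_Wc_le:
  assumes "ur \<in> Omega_c M" shows "Q (curve_state M (snd ur) (Wc M)) \<le> Q ur"
  using Q_curve_state_mono_W[of "snd ur" "Wc M" "W M ur"] Omega_cD[OF assms] by simp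

text \<open>
  The constrained problem with both states \<open>u_f (W h)\<close> has \<open>h\<close> as its
  upstream trace. The profile takes only the values \<open>u_f (W h)\<close> and \<open>h\<close>
  there, so the trace \<open>h\<close> is one of its values.
\<close>

lemma upstream_state_attained:
  assumes D: "invariant_domain M D" "Omega_f M \<subseteq> D"
    and h: "h \<in> Omega_c M" "Q h = min (Q0 M) (Q (u_c M (W M h)))" and q: "Q0 M < Q (u_f M (W M h))"
  shows "h \<in> D"
proof -
  define ul where "ul = u_f M (W M h)"
  have ul: "ul \<in> Omega_f M" "W M ul = W M h" using u_f Omega_cD(4,5)[OF h(1)] by (auto simp: ul_def)
  have N: "(ul, ul) \<in> N1 M" using ul q trace_flux_free[of ul ul] by (auto simp: mem_N1 Omega_def ul_def)
  obtain h' c where h': "h' \<in> Omega_c M" "W M h' = W M ul" "Q h' = hat_flux ul"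
      and "Q c = hat_flux ul" "downstream_choice ul c"
      and R: "\<forall>x. R1c M ul ul x = (if x < 0 then R1 M ul h' x else R1 M c ul x)"
    using R1c_constrained[OF N] .
  have "Q h' = Q h" unfolding h'(3) hat_flux_def ul(2) h(2)[symmetric] ..
  then have "h' = h" using congested_eq_of_flux[OF h'(1) h(1)] h'(2) ul(2) by simp
  have h_le: "Q h \<le> Q0 M" by (subst h(2)) simp
  have "\<exists>x<0. R1 M ul h x = h"
  proof (rule ccontr)
    assume n: "\<not> ?thesis"
    have "R1 M ul h x = ul" if "x < 0" for x
      using upstream_profile_free[OF ul(1) h(1) ul(2)[symmetric], of x] n that by blast
    then have "\<forall>\<^sub>F x in at_left 0. R1 M ul h x = ul" by (auto intro: eventually_at_leftI[of "-1"])
    then have "Lim (at_left 0) (R1 M ul h) = ul" by (rule Lim_eventually_eq) simp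
    then have "h = ul" using hat_left_trace[OF N h(1) ul(2)[symmetric] h_le] by simp
    then have "Q h = Q (u_f M (W M h))" using ul_def by metis
    then show False using h_le q by linarith
  qed
  then obtain x where "x < 0" "R1 M ul h x = h" by blast
  then have "R1c M ul ul x = h" using R \<open>h' = h\<close> by simp
  moreover have "ul \<in> D" using D(2) ul(1) by blast
  ultimately show ?thesis using invariant_domainD[OF D(1), of ul ul x] by simp
qed

text \<open>
  In the problem from \<open>u_f (W u)\<close> to \<open>ur\<close> the state \<open>u\<close> is
  the middle state. The wave leading to it moves to the left and the contact behind it moves to the
  right with speed \<open>snd u > 0\<close>, so \<open>u\<close> is the value at the origin.
\<close>

lemma transition_state_attained:
  assumes D: "invariant_domain M D" "Omega_f M \<subseteq> D"
    and u: "u \<in> Omega_c M" "u \<notin> Omega_f M" "0 < snd u" "Q u \<le> Q0 M"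
    and ur: "ur \<in> D" "ur \<in> Omega_c M" "ur \<notin> Omega_f M" "snd ur = snd u"
  shows "u \<in> D"
proof -
  define ul where "ul = u_f M (W M u)"
  have ul: "ul \<in> Omega_f M" "W M ul = W M u" using u_f Omega_cD(4,5)[OF u(1)] by (auto simp: ul_def)
  have um: "curve_state M (snd ur) (W M ul) = u" using Omega_cD(6)[OF u(1)] ur ul by simp
  have "u \<noteq> ul" using u ul by auto
  then have less: "fst ul < fst u" "Q u < Q ul" using Q_congested_less_u_f[OF u(1)] by (auto simp: ul_def)
  have "trace_flux ul ur \<le> Q0 M" using trace_flux_free_congested[OF ul(1) ur(2,3)] um u(4) by simp
  then have C: "(ul, ur) \<in> C1 M" using ul ur by (auto simp: mem_C1 Omega_def)
  have "R1 M ul ur 0 = u"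
  proof (cases "ul \<in> Omega_c M")
    case True
    then show ?thesis using wave_1_near_zero[OF True, of "snd ur"] Omega_cD(2,3)[OF ur(2)] um ur u(3)
      by (auto simp: R1_congested[OF True ur(2)])
  next
    case False
    then show ?thesis using R1_free_congested[OF ul(1) False ur(2,3), of 0] um sigma_sign(2)[OF less(1)] less(2) ur(4) u(3)
      by simp
  qed
  then have "R1c M ul ur 0 = u" using R1c_unconstrained[OF C] by simp
  then show ?thesis using invariant_domainD[OF D(1), of ul ur 0] D(2) ul ur by auto
qed

section \<open>Smallest domains containing the free phase\<close>

definition banded_domain :: "state set" where
  "banded_domain = Omega_f M \<union> {u \<in> Omega_c M. Q u \<le> Q0 M \<and> Q0 M \<le> Q (curve_state M (snd u) (Wmax M))}"

text \<open>
  Let a speed be fast if its line in the congested phase reaches the flux \<open>Q0\<close>. A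
  congested state of the domain is fast and, unless it is free, has flux at most \<open>Q0\<close>;
  speeds above a fast one are fast. A 1-wave has speeds between those of its end states and flux at
  most the larger of theirs, so both properties pass to it. A transition with a middle state of flux
  above \<open>Q0\<close> would start from a free state of at least that flux, and the problem would
  be constrained.
\<close>

lemma banded_domain_invariant:
  assumes small: "Q0 M < Q (u_c M (Wmax M))"
  shows "invariant_domain M banded_domain"
proof -
  define fast where "fast v \<longleftrightarrow> 0 \<le> v \<and> v \<le> Vc M \<and> Q0 M \<le> Q (curve_state M v (Wmax M))" for v
  have fast_Vc: "fast (Vc M)" using small Vc_range by (simp add: fast_def u_c_eq)
  have fast_mono: "fast v2" if "fast v1" "v1 \<le> v2" "v2 \<le> Vc M" for v1 v2
    using that Q_curve_state_mono_speed[of v1 v2 "Wmax M"] Wc_less_Wmax by (auto simp: fast_def)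
  have D: "banded_domain = Omega_f M \<union> {u \<in> Omega_c M. Q u \<le> Q0 M \<and> fast (snd u)}"
    using Omega_cD(2,3) by (auto simp: banded_domain_def fast_def)
  have fast_D: "fast (snd u)" if "u \<in> banded_domain" "u \<in> Omega_c M" for u
    using that fast_Vc overlap(1)[of u] by (auto simp: D)
  have flux_D: "Q u \<le> Q0 M" if "u \<in> banded_domain" "u \<notin> Omega_f M" for u
    using that by (auto simp: D)
  have curve_in_D: "curve_state M v w \<in> banded_domain"
    if "fast v" "Wc M \<le> w" "w \<le> Wmax M" "Q (curve_state M v w) \<le> Q0 M" for v w
    using that curve_state_congested(1)[of v w] by (auto simp: D fast_def)
  have fan_in_D: "curve_state M v (W M u) \<in> banded_domain"
    if u: "u \<in> Omega_c M" "fast (snd u)" "Q u \<le> Q0 M" and v': "fast v'" "Q (curve_state M v' (W M u)) \<le> Q0 M"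
      and v: "min (snd u) v' \<le> v" "v \<le> max (snd u) v'" for u v v'
  proof -
    have "fast v" using fast_mono[of "snd u" v] fast_mono[of v' v] u(2) v'(1) v
      unfolding fast_def by (cases "snd u \<le> v'") auto
    moreover have "Q (curve_state M v (W M u)) \<le> max (Q u) (Q (curve_state M v' (W M u)))"
      using Q_curve_state_mono_speed[of v "max (snd u) v'" "W M u"] Omega_cD[OF u(1)] v \<open>fast v\<close> v'
      unfolding fast_def by (auto simp: max_def split: if_splits)
    ultimately show ?thesis using curve_in_D[of v "W M u"] u v' Omega_cD[OF u(1)] by auto
  qed
  show ?thesis
  proof (rule invariant_domainI)
    show sub: "banded_domain \<subseteq> Omega M" by (auto simp: banded_domain_def Omega_def)
    fix ul ur x assume ul: "ul \<in> banded_domain" and ur: "ur \<in> banded_domain"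
    have O: "ul \<in> Omega M" "ur \<in> Omega M" using sub ul ur by auto
    note w = W_range[OF O(1)]
    {
      assume C: "trace_flux ul ur \<le> Q0 M"
      consider "ul \<in> Omega_f M" "ur \<in> Omega_f M" | "ul \<in> Omega_f M" "ur \<in> Omega_c M" "ur \<notin> Omega_f M"
        | "ul \<in> Omega_c M" "ul \<notin> Omega_f M" "ur \<in> Omega_c M"
        | "ul \<in> Omega_c M" "ul \<notin> Omega_f M" "ur \<in> Omega_f M" "ur \<notin> Omega_c M"
        using O by (auto simp: Omega_def)
      then show "R1 M ul ur x \<in> banded_domain"
      proof cases
        case 1
        then show ?thesis using R_LWR_mem[of ul ur x] R1_free[of ul ur] by (simp add: D)
      next
        case 2
        define um where "um = curve_state M (snd ur) (W M ul)"
        have um: "um \<in> Omega_c M" "W M um = W M ul" using curve_state_u_m[OF O(1) 2(2)] by (auto simp: um_def)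
        have "Q um \<le> Q0 M"
        proof (rule ccontr)
          assume n: "\<not> Q um \<le> Q0 M"
          then have "Q ul \<le> Q0 M" using C trace_flux_free_congested[OF 2] by (simp add: um_def min_le_iff_disj)
          \<comment> \<open>otherwise the middle state has at most the flux of \<open>ur\<close>, which lies on the same line of speed\<close>
          have "W M ul \<noteq> Wc M" using Q_u_m_Wc_le[OF 2(2)] flux_D[OF ur 2(3)] n by (auto simp: um_def)
          then have "u_f M (W M ul) = ul" using W_free(2) W_free_low(1) 2(1) by (meson linorder_not_le)
          then show False using Q_congested_le_u_f[OF um(1)] um n \<open>Q ul \<le> Q0 M\<close> by simp
        qed
        then have "um \<in> banded_domain" using curve_in_D[OF fast_D[OF ur 2(2)] w] by (simp add: um_def)
        then show ?thesis using R1_free_congested_mem[OF 2, of x] ul ur by (auto simp: um_def)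
      next
        case 3
        then show ?thesis
          using R1_congested_mem[OF 3(1,3), of x] fan_in_D[of ul "snd ur"] C trace_flux_congested[OF 3(1,3)]
            fast_D[OF ul] fast_D[OF ur] flux_D[OF ul] ur by auto
      next
        case 4
        have "Q (curve_state M (Vc M) (W M ul)) \<le> Q0 M"
          using Q_congested_le_u_f[of "u_c M (W M ul)"] u_c_facts[OF w] C trace_flux_congested_free[OF 4]
          by (simp add: u_c_eq)
        then have "curve_state M v (W M ul) \<in> banded_domain" if "snd ul \<le> v" "v \<le> Vc M" for v
          using fan_in_D[OF 4(1) fast_D[OF ul 4(1)] flux_D[OF ul 4(2)] fast_Vc, of v] that by auto
        then show ?thesis using R1_congested_free_mem[OF 4, of x] unfolding D by (metis (no_types, lifting) UnI1)
      qed
    }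
    {
      fix h c assume h: "h \<in> Omega_c M" "W M h = W M ul" "Q h = hat_flux ul"
        and c: "Q c = hat_flux ul" "downstream_choice ur c"
      have hq: "Q h \<le> Q0 M" "Q c \<le> Q0 M" using h c by (auto simp: hat_flux_def)
      note hD = Omega_cD[OF h(1)]
      have fast_h: "fast (snd h)"
      proof (cases "Q h = Q0 M")
        case True
        then show ?thesis using Q_curve_state_mono_W[of "snd h" "W M h" "Wmax M"] hD by (simp add: fast_def)
      next
        case False
        then have "Q h = Q (u_c M (W M ul))" using h(3) by (auto simp: hat_flux_def min_def split: if_splits)
        then have "h = u_c M (W M ul)" using congested_eq_of_flux[OF h(1)] u_c_facts[OF w] h by auto
        then show ?thesis using fast_Vc u_c_facts[OF w] by simp
      qed
      have h_D: "h \<in> banded_domain" using h hq fast_h by (auto simp: D)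
      have "R1 M ul h x \<in> banded_domain"
      proof (cases "ul \<in> Omega_f M")
        case True
        then show ?thesis using upstream_profile_free[OF True h(1,2), of x] ul h_D by auto
      next
        case False
        then have lc: "ul \<in> Omega_c M" using O by (auto simp: Omega_def)
        then show ?thesis using R1_congested_mem[OF lc h(1), of x] h_D
            fan_in_D[OF lc fast_D[OF ul lc] flux_D[OF ul False] fast_h] hD(6) h(2) hq by auto
      qed
      moreover have "R1 M c ur x \<in> banded_domain"
      proof (cases "ur \<in> Omega_c M")
        case True
        have "c \<in> banded_domain" using c(2) hq fast_D[OF ur True] True
          by (auto simp: downstream_choice_def D split: if_splits)
        moreover have "curve_state M (snd ur) (Wc M) \<in> banded_domain" if "ur \<notin> Omega_f M"
          using curve_in_D[OF fast_D[OF ur True], of "Wc M"] Q_u_m_Wc_le[OF True] flux_D[OF ur that] Wc_less_Wmax by auto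
        ultimately show ?thesis using downstream_profile_congested[OF True c(2), of x] ur by auto
      next
        case False
        then show ?thesis using downstream_profile_free[OF _ False c(2)] O by (auto simp: D Omega_def)
      qed
      ultimately show "R1 M ul h x \<in> banded_domain \<and> R1 M c ur x \<in> banded_domain" by blast
    }
  qed
qed

lemma Q_free_end: "u \<in> Omega_f M \<Longrightarrow> fst u = Rf'' M \<Longrightarrow> Q u = qmax M"
  by (auto simp: mem_Omega_f Q_def qmax_def Vmin_def)

text \<open>
  A state \<open>(v, w)\<close> of the band lies on the line of speed \<open>v\<close>, which
  reaches the flux \<open>Q0\<close> exactly in some state with a larger value of \<open>W\<close>.
  That state is an upstream trace, and a transition towards it yields \<open>(v, w)\<close>.
\<close>

lemma banded_domain_minimal:
  assumes D: "invariant_domain M D" "Omega_f M \<subseteq> D"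
  shows "banded_domain \<subseteq> D"
proof
  fix u assume u_in: "u \<in> banded_domain"
  show "u \<in> D"
  proof (cases "u \<in> Omega_f M")
    case False
    then have u: "u \<in> Omega_c M" "Q u \<le> Q0 M" "Q0 M \<le> Q (curve_state M (snd u) (Wmax M))"
      using u_in by (auto simp: banded_domain_def)
    note uD = Omega_cD[OF u(1)]
    have v: "0 < snd u" using u(3) uD(2) Q0_range(1) by (cases "snd u = 0") (auto simp: Q_def)
    obtain w where w: "W M u \<le> w" "w \<le> Wmax M" "Q (curve_state M (snd u) w) = Q0 M"
      using W_with_flux[of "snd u" "W M u" "Wmax M" "Q0 M"] u v uD by auto
    define ur where "ur = curve_state M (snd u) w"
    have ur: "ur \<in> Omega_c M" "W M ur = w" "snd ur = snd u" "Q ur = Q0 M"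
      using curve_state_congested[of "snd u" w] w uD by (auto simp: ur_def)
    \<comment> \<open>on the overlap \<open>V\<close> would be constant and \<open>u\<close> itself a free state\<close>
    have "ur \<notin> Omega_f M"
    proof
      assume f: "ur \<in> Omega_f M"
      note o = overlap[OF f ur(1)]
      have "fst ur \<noteq> Rf'' M" using Q_free_end[OF f] ur Q0_range by auto
      then have less: "fst ur < Rf'' M" using f by (auto simp: mem_Omega_f)
      have pos: "0 < fst u" using uD Rf by auto
      have "p M (fst u) \<le> p M (fst ur)" using W_congested[OF u(1)] W_congested[OF ur(1)] ur w by auto
      then have "fst u \<le> Rf'' M" using p_le_iff[OF pos, of "fst ur"] Omega_cD(1)[OF ur(1)] Rf less by auto
      moreover have "V M (fst u) = snd u" using overlap_V_const(1)[OF f ur(1) less pos] calculation o ur by simp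
      ultimately show False using False pos by (simp add: mem_Omega_f)
    qed
    note ur' = this
    have "Q ur < Q (u_f M w)"
      using Q_congested_less_u_f(2)[OF ur(1)] ur(2) ur' u_f(1)[of w] w uD by fastforce
    moreover have "Q ur \<le> Q (u_c M w)"
      using Q_curve_state_mono_speed[of "snd ur" "Vc M" w] Omega_cD[OF ur(1)] ur by (simp add: u_c_eq)
    ultimately have "ur \<in> D" using upstream_state_attained[OF D ur(1)] ur by simp
    then show ?thesis using transition_state_attained[OF D u(1) False v u(2) _ ur(1) ur' ur(3)] by simp
  qed (use D in auto)
qed

definition Vc_domain :: "state set" where
  "Vc_domain = Omega_f M \<union> {u \<in> Omega_c M. snd u = Vc M}"

lemma Q_u_c_mono:
  assumes "Wc M \<le> w1" "w1 \<le> w2" "w2 \<le> Wmax M" shows "Q (u_c M w1) \<le> Q (u_c M w2)"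
  using Q_curve_state_mono_W[of "Vc M" w1 w2] assms Vc_range by (simp add: u_c_eq)

lemma congested_Vc_eq_u_c: "u \<in> Omega_c M \<Longrightarrow> snd u = Vc M \<Longrightarrow> u = u_c M (W M u)"
  using Omega_cD(6)[of u] by (simp add: u_c_eq)

lemma u_f_Wmax: "u_f M (Wmax M) = (Rf'' M, Vmin M)" "Q (u_f M (Wmax M)) = qmax M"
proof -
  show "u_f M (Wmax M) = (Rf'' M, Vmin M)"
    using u_f_eqI[of "Rf'' M" "Wmax M"] Rf by (simp add: Wmax_def Vmin_def)
  then show "Q (u_f M (Wmax M)) = qmax M" by (simp add: Q_def qmax_def)
qed

text \<open>
  If the phases met, \<open>u_c Wmax\<close> would be the state of density \<open>Rf''\<close> and
  flux \<open>qmax > Q0\<close>.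
\<close>

lemma phases_disjoint:
  assumes large: "Q (u_c M (Wmax M)) \<le> Q0 M" and "u \<in> Omega_c M" shows "u \<notin> Omega_f M"
proof
  assume "u \<in> Omega_f M"
  then have *: "Vc M = Vmin M" using overlap(2) assms by blast
  have "u_c M (Wmax M) = (Rf'' M, Vmin M)"
    using p_inv_p[of "Rf'' M"] Rf by (simp add: u_c_def * Wmax_def)
  then show False using large Q0_range by (simp add: Q_def qmax_def)
qed

text \<open>
  No congested state of speed \<open>Vc\<close> carries more than \<open>Q0\<close>, so all upstream
  traces have speed \<open>Vc\<close>, and no waves between congested states of different speeds
  arise.
\<close>

lemma Vc_domain_invariant:
  assumes large: "Q (u_c M (Wmax M)) \<le> Q0 M"
  shows "invariant_domain M Vc_domain"
proof (rule invariant_domainI)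
  show sub: "Vc_domain \<subseteq> Omega M" by (auto simp: Vc_domain_def Omega_def)
  have u_c_in: "curve_state M (Vc M) w \<in> Vc_domain" if "Wc M \<le> w" "w \<le> Wmax M" for w
    using u_c_facts[OF that] by (simp add: Vc_domain_def u_c_eq)
  note disj = phases_disjoint[OF large]
  have speed: "snd u = Vc M" if "u \<in> Vc_domain" "u \<in> Omega_c M" for u
    using that disj by (auto simp: Vc_domain_def)
  have fan: "R1 M u1 u2 x \<in> Vc_domain" if "u1 \<in> Vc_domain" "u2 \<in> Vc_domain" "u1 \<in> Omega_c M" "u2 \<in> Omega_c M" for u1 u2 x
    using R1_congested_mem[OF that(3,4), of x] speed that u_c_in[of "W M u1"] Omega_cD[OF that(3)] by auto
  fix ul ur x assume ul: "ul \<in> Vc_domain" and ur: "ur \<in> Vc_domain"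
  have O: "ul \<in> Omega M" "ur \<in> Omega M" using sub ul ur by auto
  note w = W_range[OF O(1)]
  {
    consider "ul \<in> Omega_f M" "ur \<in> Omega_f M" | "ul \<in> Omega_f M" "ur \<in> Omega_c M" "ur \<notin> Omega_f M"
      | "ul \<in> Omega_c M" "ur \<in> Omega_c M"
      | "ul \<in> Omega_c M" "ul \<notin> Omega_f M" "ur \<in> Omega_f M" "ur \<notin> Omega_c M"
      using O by (auto simp: Omega_def)
    then show "R1 M ul ur x \<in> Vc_domain"
    proof cases
      case 1
      then show ?thesis using R_LWR_mem[of ul ur x] R1_free[of ul ur] by (simp add: Vc_domain_def)
    next
      case 2
      then show ?thesis using R1_free_congested_mem[OF 2, of x] ul ur speed[OF ur] u_c_in[OF w] by auto
    next
      case 3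
      then show ?thesis using fan ul ur by simp
    next
      case 4
      then show ?thesis using R1_congested_free_mem[OF 4, of x] speed[OF ul] u_c_in[OF w] by (auto simp: Vc_domain_def)
    qed
  }
  {
    fix h c assume h: "h \<in> Omega_c M" "W M h = W M ul" "Q h = hat_flux ul"
      and c: "Q c = hat_flux ul" "downstream_choice ur c"
    have "Q h = Q (u_c M (W M ul))"
      using h Q_u_c_mono[of "W M ul" "Wmax M"] w large by (simp add: hat_flux_def)
    then have "h = u_c M (W M ul)" using congested_eq_of_flux[OF h(1)] u_c_facts[OF w] h by auto
    then have h_D: "h \<in> Vc_domain" using u_c_in[OF w] by (simp add: u_c_eq)
    have "R1 M ul h x \<in> Vc_domain"
      using upstream_profile_free[OF _ h(1,2), of x] fan[OF ul h_D _ h(1)] ul h_D O by (auto simp: Omega_def)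
    moreover have "R1 M c ur x \<in> Vc_domain"
    proof (cases "ur \<in> Omega_c M")
      case True
      have "c \<in> Vc_domain" using c(2) True speed[OF ur True]
        by (auto simp: downstream_choice_def Vc_domain_def split: if_splits)
      then show ?thesis using downstream_profile_congested[OF True c(2), of x] ur
          u_c_in[of "Wc M"] Wc_less_Wmax speed[OF ur True] by auto
    next
      case False
      then show ?thesis using downstream_profile_free[OF _ False c(2)] O by (auto simp: Vc_domain_def Omega_def)
    qed
    ultimately show "R1 M ul h x \<in> Vc_domain \<and> R1 M c ur x \<in> Vc_domain" by blast
  }
qed

text \<open>
  The state \<open>u_c Wmax\<close> is an upstream trace, as \<open>u_f Wmax\<close> carries
  \<open>qmax > Q0\<close>. Transitions towards it give the other states of speed \<open>Vc\<close>,
  including those whose free state carries at most \<open>Q0\<close>.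
\<close>

lemma Vc_domain_minimal:
  assumes large: "Q (u_c M (Wmax M)) \<le> Q0 M" and D: "invariant_domain M D" "Omega_f M \<subseteq> D"
  shows "Vc_domain \<subseteq> D"
proof
  fix u assume u_in: "u \<in> Vc_domain"
  show "u \<in> D"
  proof (cases "u \<in> Omega_f M")
    case False
    then have u: "u \<in> Omega_c M" "snd u = Vc M" using u_in by (auto simp: Vc_domain_def)
    have w: "Wc M \<le> Wmax M" "Wmax M \<le> Wmax M" using Wc_less_Wmax by auto
    note um = u_c_facts[OF w]
    have "u_c M (Wmax M) \<in> D"
      using upstream_state_attained[OF D um(1)] um u_f_Wmax(2) large Q0_range by simp
    moreover have "Q u \<le> Q0 M"
      using congested_Vc_eq_u_c[OF u] Q_u_c_mono[of "W M u" "Wmax M"] Omega_cD[OF u(1)] large by simp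
    ultimately show ?thesis
      using transition_state_attained[OF D u(1) False, of "u_c M (Wmax M)"] um phases_disjoint[OF large um(1)] u Vc_range
      by simp
  qed (use D in auto)
qed

section \<open>Smallest domains containing the congested phase\<close>

text \<open>
  Every line of constant speed starts, at \<open>Wc\<close>, with a flux of at most that of
  \<open>u_c Wc\<close>, and every upstream trace carries at least the latter, so the downstream
  traces are congested.
\<close>

lemma Omega_c_invariant:
  assumes large: "Q (u_c M (Wc M)) \<le> Q0 M"
  shows "invariant_domain M (Omega_c M)"
proof (rule invariant_domainI)
  show "Omega_c M \<subseteq> Omega M" by (auto simp: Omega_def)
next
  fix ul ur x assume "ul \<in> Omega_c M" "ur \<in> Omega_c M"
  then show "R1 M ul ur x \<in> Omega_c M" by (rule R1_congested_closed)
next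
  fix ul ur h c x assume u: "ul \<in> Omega_c M" "ur \<in> Omega_c M" and h: "h \<in> Omega_c M"
    and c: "Q c = hat_flux ul" "downstream_choice ur c"
  note r = Omega_cD[OF u(2)] and l = Omega_cD[OF u(1)]
  have "Q (curve_state M (snd ur) (Wc M)) \<le> Q (u_c M (Wc M))"
    using Q_curve_state_mono_speed[of "snd ur" "Vc M" "Wc M"] r Wc_less_Wmax by (simp add: u_c_eq)
  also have "\<dots> \<le> Q c" using c(1) large Q_u_c_mono[of "Wc M" "W M ul"] l by (simp add: hat_flux_def)
  finally have "c \<in> Omega_c M" using c u by (simp add: downstream_choice_def)
  then show "R1 M ul h x \<in> Omega_c M \<and> R1 M c ur x \<in> Omega_c M" using R1_congested_closed u h by simp
qed

text \<open>
  The flux of \<open>u_f Wc\<close>, whose density is \<open>Rf'\<close>, is at least that of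
  \<open>u_c Wc\<close> and hence exceeds \<open>Q0\<close>.
\<close>

lemma free_low_flux:
  assumes "Q0 M < Q (u_c M (Wc M))"
  obtains u0 where "{u \<in> Omega_f' M. Q u = Q0 M} = {u0}" "u0 \<in> Omega_f M" "fst u0 < Rf' M" "Q u0 = Q0 M"
proof -
  obtain u0 where u0: "u0 \<in> Omega_f M" "Q u0 = Q0 M"
    using free_state_with_flux[of "Q0 M"] Q0_range by auto
  have w: "Wc M \<le> Wc M" "Wc M \<le> Wmax M" using Wc_less_Wmax by auto
  have "Q u0 < Q (u_f M (Wc M))"
    using Q_congested_le_u_f[OF u_c_facts(1)[OF w]] u_c_facts(2)[OF w] assms u0 by simp
  moreover have "u_f M (Wc M) = (Rf' M, V M (Rf' M))"
    using u_f_eqI[of "Rf' M" "Wc M"] Rf by (simp add: Wc_def)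
  ultimately have low: "fst u0 < Rf' M"
    using Q_free_le_iff[OF u_f(1)[OF w] u0(1)] by (auto simp: not_le[symmetric])
  have "{u \<in> Omega_f' M. Q u = Q0 M} = {u0}"
    using u0 low free_eqI[OF _ u0(1)] by (auto simp: Omega_f'_def)
  then show thesis using that u0 low by blast
qed

text \<open>
  A problem between congested states that is constrained has flux exactly \<open>Q0\<close> at the
  origin, so a free downstream trace is the additional state \<open>u0\<close>. A problem from a
  congested state to \<open>u0\<close> is always constrained and has \<open>u0\<close> as its
  downstream trace, so no other free state appears.
\<close>

lemma extended_congested_domain_invariant:
  assumes small: "Q0 M < Q (u_c M (Wc M))"
  shows "invariant_domain M (Omega_c M \<union> {u \<in> Omega_f' M. Q u = Q0 M})"
proof -
  obtain u0 where D: "{u \<in> Omega_f' M. Q u = Q0 M} = {u0}" and u0: "u0 \<in> Omega_f M" "fst u0 < Rf' M" "Q u0 = Q0 M"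
    using free_low_flux[OF small] .
  note u0_low = W_free_low[OF u0(1,2)]
  have w: "Wc M \<le> Wc M" "Wc M \<le> Wmax M" using Wc_less_Wmax by auto
  show ?thesis unfolding D
  proof (rule invariant_domainI)
    show "Omega_c M \<union> {u0} \<subseteq> Omega M" using u0 by (auto simp: Omega_def)
    fix ul ur x assume ul: "ul \<in> Omega_c M \<union> {u0}" and ur: "ur \<in> Omega_c M \<union> {u0}"
    have flux_u_c: "Q0 M < Q (u_c M (W M u))" if "u \<in> Omega_c M" for u
      using small Q_u_c_mono[of "Wc M" "W M u"] Omega_cD[OF that] by simp
    {
      assume C: "trace_flux ul ur \<le> Q0 M"
      consider "ul \<in> Omega_c M" "ur \<in> Omega_c M" | "ul = u0" "ur \<in> Omega_c M" "ur \<notin> Omega_f M"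
        | "ul = u0" "ur \<in> Omega_f M" "fst u0 \<le> fst ur" | "ul \<in> Omega_c M" "ur = u0"
        using ul ur Omega_cD(1)[of ur] u0 by fastforce
      then show "R1 M ul ur x \<in> Omega_c M \<union> {u0}"
      proof cases
        case 1
        then show ?thesis using R1_congested_closed by simp
      next
        case 2
        then show ?thesis
          using R1_free_congested_mem[OF u0(1) 2(2,3), of x] curve_state_u_m(1)[OF Omega_fI[OF u0(1)] 2(2)] by auto
      next
        case 3
        then show ?thesis using R_LWR_shock[of u0 ur x] R1_free[OF u0(1) 3(2)] ur by auto
      next
        case 4
        have "Q0 M < trace_flux ul ur"
        proof (cases "ul \<in> Omega_f M")
          case True
          then show ?thesis using trace_flux_free[OF True u0(1)] flux_u_c[OF 4(1)] 4
              congested_Vc_eq_u_c[OF 4(1)] overlap(1)[OF True 4(1)] by simp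
        next
          case False
          have wl: "Wc M \<le> W M ul" "W M ul \<le> Wmax M" using Omega_cD[OF 4(1)] by auto
          show ?thesis using trace_flux_congested_free[OF 4(1) False u0(1) u0_low(2)] flux_u_c[OF 4(1)] 4
              Q_congested_le_u_f[OF u_c_facts(1)[OF wl]] u_c_facts(2)[OF wl] by simp
        qed
        then show ?thesis using C by simp
      qed
    }
    {
      fix h c assume N: "Q0 M < trace_flux ul ur" and h: "h \<in> Omega_c M" "W M h = W M ul" "Q h = hat_flux ul"
        and c: "Q c = hat_flux ul" "downstream_choice ur c"
      have "ul \<in> Omega_c M"
      proof (rule ccontr)
        assume "ul \<notin> Omega_c M"
        then have "ul = u0" using ul by simp
        moreover have "ul \<in> Omega M" "ur \<in> Omega M" using ul ur u0 by (auto simp: Omega_def)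
        ultimately show False using N1_upstream_free[of u0 ur] N u0 by (auto simp: mem_N1)
      qed
      note lc = this
      have "Q c = Q0 M" using c(1) flux_u_c[OF lc] by (simp add: hat_flux_def)
      then have c0: "c = u0" if "c \<in> Omega_f M" using free_eqI[OF that u0(1)] u0 by simp
      have "R1 M c ur x \<in> Omega_c M \<union> {u0}"
      proof (cases "ur \<in> Omega_c M")
        case True
        have "c \<in> Omega_c M \<union> {u0}" using c(2) c0 True by (auto simp: downstream_choice_def split: if_splits)
        then show ?thesis using downstream_profile_congested[OF True c(2), of x] ur
          curve_state_congested(1)[of "snd ur" "Wc M"] w Omega_cD[OF True] by auto
      next
        case False
        then have "ur = u0" "c = u0" using ur downstream_profile_free(1)[OF _ False c(2)] u0 c0 by auto
        then show ?thesis using R_LWR_shock[of u0 u0 x] R1_free[OF u0(1) u0(1)] by simp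
      qed
      then show "R1 M ul h x \<in> Omega_c M \<union> {u0} \<and> R1 M c ur x \<in> Omega_c M \<union> {u0}"
        using R1_congested_closed[OF lc h(1)] by simp
    }
  qed
qed

text \<open>
  In the problem with both states \<open>u_c Wc\<close> the flux \<open>Q0\<close> is below that of
  any congested state of speed \<open>Vc\<close>, so the downstream trace is free.
\<close>

lemma extended_congested_domain_minimal:
  assumes small: "Q0 M < Q (u_c M (Wc M))" and D: "invariant_domain M D" "Omega_c M \<subseteq> D"
  shows "Omega_c M \<union> {u \<in> Omega_f' M. Q u = Q0 M} \<subseteq> D"
proof -
  obtain u0 where u0: "{u \<in> Omega_f' M. Q u = Q0 M} = {u0}" "u0 \<in> Omega_f M" "fst u0 < Rf' M" "Q u0 = Q0 M"
    using free_low_flux[OF small] .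
  have w: "Wc M \<le> Wc M" "Wc M \<le> Wmax M" using Wc_less_Wmax by auto
  define ul where "ul = u_c M (Wc M)"
  note l = u_c_facts[OF w, folded ul_def]
  have um: "curve_state M (snd ul) (Wc M) = ul" using Omega_cD(6)[OF l(1)] l by simp
  have N: "(ul, ul) \<in> N1 M"
    using trace_flux_congested[OF l(1) l(1)] um l small by (simp add: mem_N1 Omega_def ul_def)
  obtain h c where "h \<in> Omega_c M" "W M h = W M ul" "Q h = hat_flux ul" and c: "Q c = hat_flux ul" "downstream_choice ul c"
    "\<forall>x. R1c M ul ul x = (if x < 0 then R1 M ul h x else R1 M c ul x)"
    using R1c_constrained[OF N] .
  have q: "Q c = Q0 M" using c(1) small l(2) by (simp add: hat_flux_def ul_def)
  then have less: "Q c < Q ul" using small by (simp add: ul_def)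
  then have cf: "c \<in> Omega_f M" "fst c < Rf' M" using c(2) l(1) um by (auto simp: downstream_choice_def)
  then have "c = u0" using free_eqI u0 q by metis
  have "R1 M c ul 0 = c"
  proof (cases "ul \<in> Omega_f M")
    case True
    then show ?thesis using R1_free[OF cf(1) True] R_LWR_at_nonpos[OF cf(1) True] by simp
  next
    case False
    have "fst c < fst ul" using cf Omega_cD(1)[OF l(1)] by simp
    then have "0 < sigma c ul" using sigma_sign(1) less by blast
    then show ?thesis
      using R1_free_congested[OF cf(1) W_free_low(2)[OF cf] l(1) False, of 0] um W_free_low(1)[OF cf] by simp
  qed
  then have "R1c M ul ul 0 = u0" using c(3) \<open>c = u0\<close> by simp
  then have "u0 \<in> D" using invariant_domainD[OF D(1), of ul ul 0] D(2) l(1) by auto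
  then show ?thesis using D(2) u0(1) by simp
qed

end

theorem proposition3p3:
  fixes M :: traffic_data
  assumes "traffic_model M"
  shows
    "(Q0 M < Q (u_c M (Wmax M)) \<longrightarrow>
        smallest_invariant_domain M (Omega_f M)
          (Omega_f M \<union>
             {(\<rho>, v) \<in> Omega_c M. Q (\<rho>, v) \<le> Q0 M \<and> Q0 M \<le> p_inv M (Wmax M - v) * v})) \<and>
     (Q0 M \<ge> Q (u_c M (Wmax M)) \<longrightarrow>
        smallest_invariant_domain M (Omega_f M)
          (Omega_f M \<union> {(\<rho>, v) \<in> Omega_c M. v = Vc M})) \<and>
     (Q0 M \<ge> Q (u_c M (Wc M)) \<longrightarrow>
        smallest_invariant_domain M (Omega_c M) (Omega_c M)) \<and>
     (Q0 M < Q (u_c M (Wc M)) \<longrightarrow>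
        smallest_invariant_domain M (Omega_c M)
          (Omega_c M \<union> {u \<in> Omega_f' M. Q u = Q0 M}))"
proof -
  interpret traffic_model M by fact
  have a: "Omega_f M \<union> {(\<rho>, v) \<in> Omega_c M. Q (\<rho>, v) \<le> Q0 M \<and> Q0 M \<le> p_inv M (Wmax M - v) * v} = banded_domain"
    by (auto simp: banded_domain_def curve_state_def Q_def)
  have b: "Omega_f M \<union> {(\<rho>, v) \<in> Omega_c M. v = Vc M} = Vc_domain"
    by (auto simp: Vc_domain_def)
  have sub: "Omega_f M \<subseteq> banded_domain" "Omega_f M \<subseteq> Vc_domain" by (auto simp: banded_domain_def Vc_domain_def)
  show ?thesis unfolding a b smallest_invariant_domain_def
  proof (intro conjI impI allI, goal_cases)
    case 1 then show ?case by (rule banded_domain_invariant)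
  next
    case 3 then show ?case using banded_domain_minimal by simp
  next
    case 4 then show ?case by (rule Vc_domain_invariant)
  next
    case 6 then show ?case using Vc_domain_minimal by simp
  next
    case 7 then show ?case by (rule Omega_c_invariant)
  next
    case 10 then show ?case by (rule extended_congested_domain_invariant)
  next
    case 12 then show ?case using extended_congested_domain_minimal by simp
  qed (use sub in auto)
qed

end
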